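(* For every integer $n\ge1$: $|\mathcal D(\delta_{n+2}/\delta_n)|=s_n$ and $|\mathcal D(\delta_{n+4}/\delta_n)|=\tfrac12\big(s_ns_{n+2}-s_{n+1}^2\big)$. More generally, for all $k\ge1$, $$|\mathcal D(\delta_{n+2k}/\delta_n)|=2^{-\binom{k}{2}}\det\big[s_{n-2+i+j}\big]_{i,j=1}^k.$$
   Context: $\delta_m$ denotes the staircase partition $(m-1,m-2,\dots,1)$, identified with its Young diagram $\{(i,j):1\le j\le m-i\}$ (English convention). $s_m$ is the $m$-th little Schröder number: the number of lattice paths from $(0,0)$ to $(m,m)$ with steps $(1,0),(0,1),(1,1)$ that never go below the diagonal $x=y$ and have no $(1,1)$ step on that diagonal ($s_1=1,s_2=3,s_3=11,\dots$). Generalized excited diagrams: for a set $S$ of cells of a Young diagram $\lambda$, a cell $(i,j)\in S$ is active if $(i+1,j),(i,j+1),(i+1,j+1)\in\lambda\setminus S$; for active $(i,j)$ the type I move replaces $(i,j)$ by $(i+1,j+1)$ and the type II move adds $(i+1,j+1)$ to $S$. For $\mu\subseteq\lambda$, $\mathcal D(\lambda/\mu)$ is the set of subsets of $\lambda$ obtainable from the diagram of $\mu$ by sequences of type I and II moves. *)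

theory Defs
  imports Main "Jordan_Normal_Form.Determinant"
begin

text \<open>Cells are pairs (i,j) of positive integers (row, column), English convention.\<close>

definition staircase :: "nat \<Rightarrow> (nat \<times> nat) set" where
  "staircase m = {(i, j). 1 \<le> i \<and> 1 \<le> j \<and> i + j \<le> m}"

definition active :: "(nat \<times> nat) set \<Rightarrow> (nat \<times> nat) set \<Rightarrow> nat \<times> nat \<Rightarrow> bool" where
  "active lam S c = (case c of (i, j) \<Rightarrow>
     (i, j) \<in> S \<and> (i + 1, j) \<in> lam - S \<and> (i, j + 1) \<in> lam - S \<and> (i + 1, j + 1) \<in> lam - S)"

inductive_set excited :: "(nat \<times> nat) set \<Rightarrow> (nat \<times> nat) set \<Rightarrow> (nat \<times> nat) set set"
  for lam :: "(nat \<times> nat) set" and mu :: "(nat \<times> nat) set" where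
  base: "mu \<in> excited lam mu"
| typeI: "S \<in> excited lam mu \<Longrightarrow> active lam S (i, j) \<Longrightarrow>
          insert (i + 1, j + 1) (S - {(i, j)}) \<in> excited lam mu"
| typeII: "S \<in> excited lam mu \<Longrightarrow> active lam S (i, j) \<Longrightarrow>
          insert (i + 1, j + 1) S \<in> excited lam mu"

datatype step = StepE | StepN | StepD

fun step_dx :: "step \<Rightarrow> int" where
  "step_dx StepE = 1" | "step_dx StepN = 0" | "step_dx StepD = 1"

fun step_dy :: "step \<Rightarrow> int" where
  "step_dy StepE = 0" | "step_dy StepN = 1" | "step_dy StepD = 1"

definition pos :: "step list \<Rightarrow> nat \<Rightarrow> int \<times> int" where
  "pos ps t = (sum_list (map step_dx (take t ps)), sum_list (map step_dy (take t ps)))"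

definition schroeder_path :: "nat \<Rightarrow> step list \<Rightarrow> bool" where
  "schroeder_path m ps \<longleftrightarrow>
     pos ps (length ps) = (int m, int m) \<and>
     (\<forall>t \<le> length ps. fst (pos ps t) \<le> snd (pos ps t)) \<and>
     (\<forall>t < length ps. ps ! t = StepD \<longrightarrow> fst (pos ps t) \<noteq> snd (pos ps t))"

definition little_schroeder :: "nat \<Rightarrow> nat" where
  "little_schroeder m = card {ps. schroeder_path m ps}"

end

theory Submission
  imports Defs
begin

text \<open>Record a generalized excited diagram by the sets of displacements of the cells of the inner
  staircase along their diagonals. The diagrams then become the set-valued fillings of the staircase with
  entries in \<open>{0..k}\<close> that weakly increase in the sense \<open>max T c \<le> min T c'\<close>. Grouping them by their minima
  \<open>t\<close> gives the sum over reverse plane partitions \<open>t\<close> of \<open>2\<close> to the power \<open>\<Sum> (m c - t c)\<close>, where \<open>m c\<close> is the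
  smaller of the entries to the right of and below \<open>c\<close>. Piecewise-linear toggles of whole antidiagonals turn
  this exponent into the alternating sum of the antidiagonal sums. Read along the diagonals, the resulting
  sum counts families of \<open>k\<close> nonintersecting Dyck paths in which an up step from an odd to an even height
  has weight 2, so it is a \<open>k \<times> k\<close> minor of the \<open>n\<close>-th power of the tridiagonal matrix \<open>walk 1\<close>. The
  \<open>(0, 0)\<close> entry of that power is the little Schroeder number, and the Hankel matrix factors as a lower
  triangular matrix with diagonal \<open>2 ^ a\<close>, this minor's matrix, and an upper unitriangular one.\<close>


text \<open>After grouping by minima the exponent of \<open>t\<close> still contains minima of
  neighbouring entries, so it is not a sum of weights of single path steps; the toggles serve to
  make it linear. The sign that a cell then receives depends on the parity of its antidiagonal, and
  this parity also determines that of its diagonal. This coincidence allows the exponent to be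
  regrouped by diagonals, where differences of neighbouring diagonal sums count the paths that rise
  between them. Each power of \<open>walk 1\<close> is taken in two half steps, because neighbouring
  diagonals interlace in alternating directions; \<open>walk 1\<close> is the product of the two
  bidiagonal matrices. Nonintersection does not come from an involution on path families: the minors
  are expanded by multilinearity one half step at a time, and a term with colliding paths is a
  determinant with two equal rows. Exponents of 2 are kept as integers so that signed terms can be
  moved freely between factors.\<close>

section \<open>Set-valued fillings\<close>

text \<open>\<open>T (i, j)\<close> is the set of displacements \<open>a\<close> for which the translate \<open>(i + a, j + a)\<close> of the cell
  \<open>(i, j)\<close> belongs to the diagram. The diagonal neighbours need no condition of their own.\<close>

definition svt :: "nat \<Rightarrow> nat \<Rightarrow> (nat \<times> nat \<Rightarrow> nat set) set" where
  "svt n k = {T. (\<forall>c. c \<notin> staircase n \<longrightarrow> T c = {}) \<and>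
     (\<forall>c\<in>staircase n. T c \<noteq> {} \<and> T c \<subseteq> {..k}) \<and>
     (\<forall>i j. \<forall>a\<in>T (i, j). \<forall>b\<in>T (Suc i, j) \<union> T (i, Suc j). a \<le> b)}"

definition place :: "(nat \<times> nat \<Rightarrow> nat set) \<Rightarrow> (nat \<times> nat) set" where
  "place T = {(i + a, j + a) |i j a. a \<in> T (i, j)}"

lemma staircase_iff: "(i, j) \<in> staircase m \<longleftrightarrow> 1 \<le> i \<and> 1 \<le> j \<and> i + j \<le> m"
  by (simp add: staircase_def)

lemma finite_staircase: "finite (staircase m)"
  by (rule finite_subset[of _ "{..m} \<times> {..m}"]) (auto simp: staircase_def)

lemma svt_outside: "T \<in> svt n k \<Longrightarrow> c \<notin> staircase n \<Longrightarrow> T c = {}"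
  unfolding svt_def by blast

lemma svt_inside: "T \<in> svt n k \<Longrightarrow> c \<in> staircase n \<Longrightarrow> T c \<noteq> {} \<and> T c \<subseteq> {..k}"
  unfolding svt_def by blast

lemma svt_cell: "T \<in> svt n k \<Longrightarrow> a \<in> T (i, j) \<Longrightarrow> 1 \<le> i \<and> 1 \<le> j \<and> i + j \<le> n"
  using svt_outside[of T n k "(i, j)"] staircase_iff[of i j n] by blast

lemma svt_nonempty: "T \<in> svt n k \<Longrightarrow> 1 \<le> i \<Longrightarrow> 1 \<le> j \<Longrightarrow> i + j \<le> n \<Longrightarrow> \<exists>a. a \<in> T (i, j)"
  using svt_inside[of T n k "(i, j)"] staircase_iff[of i j n] by blast

lemma svt_le: "T \<in> svt n k \<Longrightarrow> a \<in> T (i, j) \<Longrightarrow> a \<le> k"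
  using svt_inside[of T n k "(i, j)"] svt_outside[of T n k "(i, j)"] by blast

lemma svt_down: "T \<in> svt n k \<Longrightarrow> a \<in> T (i, j) \<Longrightarrow> b \<in> T (Suc i, j) \<Longrightarrow> a \<le> b"
  unfolding svt_def by blast

lemma svt_right: "T \<in> svt n k \<Longrightarrow> a \<in> T (i, j) \<Longrightarrow> b \<in> T (i, Suc j) \<Longrightarrow> a \<le> b"
  unfolding svt_def by blast

text \<open>The neighbour inequalities chain together because every intermediate cell lies in the
  staircase and therefore has an entry to pass through.\<close>

lemma svt_mono:
  assumes T: "T \<in> svt n k"
  shows "a \<in> T (i, j) \<Longrightarrow> b \<in> T (i + d, j + e) \<Longrightarrow> 0 < d + e \<Longrightarrow> a \<le> b"
proof (induction "d + e" arbitrary: d e b rule: less_induct)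
  case less
  have ij: "1 \<le> i" "1 \<le> j" and de: "i + d + (j + e) \<le> n"
    using svt_cell[OF T] less.prems by blast+
  consider d' where "d = Suc d'" | e' where "d = 0" "e = Suc e'"
    using less.prems(3) by (cases d; cases e) auto
  then show ?case
  proof cases
    case 1
    show ?thesis
    proof (cases "d' + e = 0")
      case True
      then show ?thesis using 1 less.prems svt_down[OF T] by simp
    next
      case False
      have "1 \<le> i + d'" "1 \<le> j + e" "(i + d') + (j + e) \<le> n" using ij de 1 by auto
      then obtain c where c: "c \<in> T (i + d', j + e)" using svt_nonempty[OF T] by blast
      have "a \<le> c" using less.hyps[of d' e c] less.prems(1) c False 1 by simp
      moreover have "c \<le> b" using svt_down[OF T c] less.prems(2) 1 by simp
      ultimately show ?thesis by simp
    qed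
  next
    case 2
    show ?thesis
    proof (cases "e' = 0")
      case True
      then show ?thesis using 2 less.prems svt_right[OF T] by simp
    next
      case False
      have "1 \<le> i" "1 \<le> j + e'" "i + (j + e') \<le> n" using ij de 2 by auto
      then obtain c where c: "c \<in> T (i, j + e')" using svt_nonempty[OF T] by blast
      have "a \<le> c" using less.hyps[of 0 e' c] less.prems(1) c False 2 by simp
      moreover have "c \<le> b" using svt_right[OF T c] less.prems(2) 2 by simp
      ultimately show ?thesis by simp
    qed
  qed
qed

text \<open>Along a diagonal, two representations of one cell would trade displacement for distance
  from the origin: the outer base cell would have the smaller entry, against
  \<open>svt_mono\<close>.\<close>

lemma place_unique:
  assumes T: "T \<in> svt n k" and ab: "a \<in> T (i, j)" "b \<in> T (i', j')"
    and eq: "i + a = i' + b" "j + a = j' + b"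
  shows "i' = i \<and> j' = j \<and> b = a"
proof -
  have "\<not> i < i'"
  proof
    assume "i < i'"
    then obtain e where e: "i' = i + e" "e > 0" using less_imp_add_positive by blast
    then have "j' = j + e" "a = b + e" using eq by linarith+
    then show False using svt_mono[OF T ab(1), of b e e] ab(2) e by simp
  qed
  moreover have "\<not> i' < i"
  proof
    assume "i' < i"
    then obtain e where e: "i = i' + e" "e > 0" using less_imp_add_positive by blast
    then have "j = j' + e" "b = a + e" using eq by linarith+
    then show False using svt_mono[OF T ab(2), of a e e] ab(1) e by simp
  qed
  ultimately show ?thesis using eq by linarith
qed

lemma place_iff: "(x, y) \<in> place T \<longleftrightarrow> (\<exists>i j a. a \<in> T (i, j) \<and> x = i + a \<and> y = j + a)"
  unfolding place_def by auto

lemma place_mem: "a \<in> T (i, j) \<Longrightarrow> (i + a, j + a) \<in> place T"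
  unfolding place_iff by blast

section \<open>Excited moves as changes of one set of a filling\<close>

lemma place_insert:
  "place (T((i, j) := insert a (T (i, j)))) = insert (i + a, j + a) (place T)" (is "place ?T = _")
proof -
  have T: "b \<in> ?T (i', j') \<longleftrightarrow> (i', j', b) = (i, j, a) \<or> b \<in> T (i', j')" for i' j' b
    by auto
  show ?thesis unfolding set_eq_iff split_paired_All place_iff insert_iff T by blast
qed

lemma place_remove:
  assumes T: "T \<in> svt n k" and a: "a \<in> T (i, j)"
  shows "place (T((i, j) := T (i, j) - {a})) = place T - {(i + a, j + a)}" (is "place ?T = _")
proof -
  have T: "b \<in> ?T (i', j') \<longleftrightarrow> b \<in> T (i', j') \<and> (i' + b, j' + b) \<noteq> (i + a, j + a)" for i' j' b
    using place_unique[OF T a, of b i' j'] by auto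
  show ?thesis unfolding set_eq_iff split_paired_All place_iff Diff_iff singleton_iff T by metis
qed

lemma svt_update:
  assumes T: "T \<in> svt n k" and ij: "1 \<le> i" "1 \<le> j" "i + j \<le> n"
    and A: "A \<noteq> {}" "A \<subseteq> {..k}"
    and out: "\<And>a b. a \<in> A \<Longrightarrow> b \<in> T (Suc i, j) \<union> T (i, Suc j) \<Longrightarrow> a \<le> b"
    and inn: "\<And>a b i' j'. a \<in> A \<Longrightarrow> b \<in> T (i', j') \<Longrightarrow> (Suc i', j') = (i, j) \<or> (i', Suc j') = (i, j) \<Longrightarrow> b \<le> a"
  shows "T((i, j) := A) \<in> svt n k"
proof -
  let ?T = "T((i, j) := A)"
  have "?T c = {}" if "c \<notin> staircase n" for c
    using that svt_outside[OF T] staircase_iff[of i j n] ij by auto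
  moreover have "?T c \<noteq> {} \<and> ?T c \<subseteq> {..k}" if "c \<in> staircase n" for c
    using that svt_inside[OF T, of c] A by simp
  moreover have "a \<le> b" if "a \<in> ?T (i', j')" "b \<in> ?T (Suc i', j') \<union> ?T (i', Suc j')" for i' j' a b
  proof (cases "(i', j') = (i, j)")
    case True
    then show ?thesis using that out by auto
  next
    case False
    then have "?T (i', j') = T (i', j')" by (intro fun_upd_other) simp
    then have a: "a \<in> T (i', j')" using that by simp
    from that(2) show ?thesis
    proof
      assume "b \<in> ?T (Suc i', j')"
      then show ?thesis using a inn svt_down[OF T a] by (cases "(Suc i', j') = (i, j)") auto
    next
      assume "b \<in> ?T (i', Suc j')"
      then show ?thesis using a inn svt_right[OF T a] by (cases "(i', Suc j') = (i, j)") auto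
    qed
  qed
  ultimately show ?thesis unfolding svt_def by blast
qed

text \<open>The three vacant cells required of an active cell say that \<open>Suc a\<close> is
  missing from the same set and \<open>a\<close> from the sets below and to the right. Entries there
  are at least \<open>a\<close>, hence at least \<open>Suc a\<close>, which leaves room for the new
  entry.\<close>

lemma place_step:
  assumes T: "T \<in> svt n k" and a: "a \<in> T (i, j)"
    and act: "active (staircase (n + 2 * k)) (place T) (i + a, j + a)"
  shows "insert (i + a + 1, j + a + 1) (place T) \<in> place ` svt n k"
    and "insert (i + a + 1, j + a + 1) (place T - {(i + a, j + a)}) \<in> place ` svt n k"
proof -
  note cell = svt_cell[OF T a]
  have free: "Suc a \<notin> T (i, j)" "a \<notin> T (Suc i, j)" "a \<notin> T (i, Suc j)"
    and lam: "i + a + 1 + (j + a + 1) \<le> n + 2 * k"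
    using act place_mem[of "Suc a" T i j] place_mem[of a T "Suc i" j] place_mem[of a T i "Suc j"]
    by (auto simp: active_def staircase_iff)
  \<comment> \<open>On the outermost antidiagonal of the inner staircase the bound is exactly the
    size \<open>n + 2 * k\<close> of the outer one; elsewhere an entry of the cell below exceeds
    \<open>a\<close>.\<close>
  have ak: "Suc a \<le> k"
  proof (cases "i + j = n")
    case True
    then show ?thesis using lam by simp
  next
    case False
    then obtain b where b: "b \<in> T (Suc i, j)" using svt_nonempty[OF T, of "Suc i" j] cell by auto
    then have "b \<noteq> a" using free by blast
    then show ?thesis using svt_down[OF T a b] svt_le[OF T b] by simp
  qed
  have out: "c \<le> b" if "c \<in> insert (Suc a) (T (i, j))" "b \<in> T (Suc i, j) \<union> T (i, Suc j)" for c b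
  proof (cases "c = Suc a")
    case True
    have "a \<le> b" using that(2) svt_down[OF T a] svt_right[OF T a] by blast
    moreover have "b \<noteq> a" using that(2) free by blast
    ultimately show ?thesis using True by simp
  next
    case False
    then show ?thesis using that svt_down[OF T] svt_right[OF T] by blast
  qed
  have inn: "b \<le> c" if "c \<in> insert (Suc a) (T (i, j))" "b \<in> T (i', j')"
      "(Suc i', j') = (i, j) \<or> (i', Suc j') = (i, j)" for b c i' j'
  proof -
    have "b \<le> c'" if "c' \<in> T (i, j)" for c'
      using \<open>b \<in> T (i', j')\<close> \<open>(Suc i', j') = (i, j) \<or> (i', Suc j') = (i, j)\<close> svt_down[OF T] svt_right[OF T] that
      by blast
    from this[of a] this[of c] show ?thesis using that(1) a by auto
  qed
  have sub: "T (i, j) \<subseteq> {..k}" using svt_le[OF T] by blast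
  define T1 where "T1 = T((i, j) := insert (Suc a) (T (i, j)))"
  define T2 where "T2 = T((i, j) := insert (Suc a) (T (i, j)) - {a})"
  have T1: "T1 \<in> svt n k" unfolding T1_def
    by (rule svt_update[OF T]) (use cell ak sub out inn in auto)
  have T2: "T2 \<in> svt n k" unfolding T2_def
    by (rule svt_update[OF T]) (use cell ak sub out inn in auto)
  have p1: "place T1 = insert (i + a + 1, j + a + 1) (place T)"
    unfolding T1_def using place_insert[of T i j "Suc a"] by simp
  have "T2 = T1((i, j) := T1 (i, j) - {a})" unfolding T1_def T2_def by simp
  then have "place T2 = place T1 - {(i + a, j + a)}"
    using place_remove[OF T1, of a i j] a by (simp add: T1_def)
  then have p2: "place T2 = insert (i + a + 1, j + a + 1) (place T - {(i + a, j + a)})"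
    using p1 by auto
  show "insert (i + a + 1, j + a + 1) (place T) \<in> place ` svt n k"
    using T1 p1 by (metis imageI)
  show "insert (i + a + 1, j + a + 1) (place T - {(i + a, j + a)}) \<in> place ` svt n k"
    using T2 p2 by (metis imageI)
qed

definition svt0 :: "nat \<Rightarrow> nat \<times> nat \<Rightarrow> nat set" where
  "svt0 n = (\<lambda>c. if c \<in> staircase n then {0} else {})"

lemma svt0: "svt0 n \<in> svt n k" "place (svt0 n) = staircase n"
  by (auto simp: svt0_def svt_def place_def split: if_splits)

lemma excited_imp_place:
  "S \<in> excited (staircase (n + 2 * k)) (staircase n) \<Longrightarrow> S \<in> place ` svt n k"
proof (induction rule: excited.induct)
  case base
  then show ?case using svt0 by (metis imageI)
next
  case (typeI S i j)
  then obtain T where T: "T \<in> svt n k" "S = place T" by blast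
  then obtain i' j' a where "(i, j) = (i' + a, j' + a)" "a \<in> T (i', j')"
    using typeI.hyps(2) unfolding active_def by (auto simp: place_iff)
  then show ?case using place_step(2)[OF T(1)] typeI.hyps(2) T(2) by simp
next
  case (typeII S i j)
  then obtain T where T: "T \<in> svt n k" "S = place T" by blast
  then obtain i' j' a where "(i, j) = (i' + a, j' + a)" "a \<in> T (i', j')"
    using typeII.hyps(2) unfolding active_def by (auto simp: place_iff)
  then show ?case using place_step(1)[OF T(1)] typeII.hyps(2) T(2) by simp
qed

section \<open>Injectivity of the encoding and reachability of every filling\<close>

lemma place_inj_aux:
  assumes T: "T \<in> svt n k" and T': "T' \<in> svt n k"
    and eq: "\<And>i j a. i + j + 2 * a < s \<Longrightarrow> a \<in> T (i, j) \<longleftrightarrow> a \<in> T' (i, j)"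
    and a: "a \<in> T (i, j)" "i + j + 2 * a = s"
    and b: "b \<in> T' (i', j')" "i + a = i' + b" "j + a = j' + b"
  shows "\<not> i < i'"
proof
  assume "i < i'"
  then obtain e where e: "i' = Suc (i + e)" using less_imp_Suc_add by blast
  then have j': "j' = Suc (j + e)" and ab: "a = Suc (b + e)" using b by linarith+
  have "i + e + (j' ) \<le> n" "1 \<le> i" using svt_cell[OF T' b(1)] svt_cell[OF T a(1)] e by auto
  \<comment> \<open>The cell \<open>(i + e, j')\<close> lies directly above \<open>(i', j')\<close>.
    Its entry \<open>u\<close> is at most \<open>b\<close>, so \<open>i + e + j' + 2 * u < s\<close>
    and both fillings contain \<open>u\<close> there. Read in \<open>T\<close>, it must be at least
    \<open>a\<close>, although \<open>a > b\<close>.\<close>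
  then obtain u where u: "u \<in> T' (i + e, j')" using svt_nonempty[OF T', of "i + e" j'] e j' by auto
  have "u \<le> b" using svt_down[OF T' u] b(1) e by simp
  then have "u \<in> T (i + e, j + Suc e)" using eq[of "i + e" j' u] u a(2) j' ab by simp
  then have "a \<le> u" using svt_mono[OF T a(1)] by fastforce
  then show False using \<open>u \<le> b\<close> ab by simp
qed

text \<open>A cell of \<open>place T\<close> can be attributed to two different cells of the staircase only if some cell
  closer to the origin is: the cell above the later candidate holds a smaller entry.\<close>

lemma place_inj: "inj_on place (svt n k)"
proof (rule inj_onI)
  fix T T' assume T: "T \<in> svt n k" and T': "T' \<in> svt n k" and eq: "place T = place T'"
  have "\<forall>i j a. i + j + 2 * a = s \<longrightarrow> (a \<in> T (i, j) \<longleftrightarrow> a \<in> T' (i, j))" for s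
  proof (induction s rule: less_induct)
    case (less s)
    have "a \<in> T2 (i, j)" if h: "T1 \<in> svt n k" "T2 \<in> svt n k" "place T1 = place T2"
        "\<And>i j a. i + j + 2 * a < s \<Longrightarrow> a \<in> T1 (i, j) \<longleftrightarrow> a \<in> T2 (i, j)"
        "i + j + 2 * a = s" "a \<in> T1 (i, j)" for T1 T2 i j a
    proof -
      have "(i + a, j + a) \<in> place T2" using place_mem[of a T1 i j] h by simp
      then obtain i' j' b where b: "b \<in> T2 (i', j')" "i + a = i' + b" "j + a = j' + b"
        unfolding place_iff by auto
      have "\<not> i < i'" using place_inj_aux[of T1 n k T2 s a i j b i' j'] h b by blast
      moreover have "\<not> i' < i"
        using place_inj_aux[of T2 n k T1 s b i' j' a i j] h b by auto
      ultimately show ?thesis using b by simp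
    qed
    from this[of T T'] this[of T' T] show ?case using T T' eq less.IH by metis
  qed
  then show "T = T'" by (auto simp: fun_eq_iff)
qed

text \<open>A move is undone by lowering the maximum of one set by 1. Taking a cell other than
  \<open>{0}\<close> as close to the origin as possible makes all entries above it and to its left
  0, so the lowered value is still admissible.\<close>

lemma place_unstep:
  assumes T: "T \<in> svt n k" and ne: "T \<noteq> svt0 n"
  obtains T1 where "T1 \<in> svt n k" "(\<Sum>c\<in>staircase n. Max (T1 c)) < (\<Sum>c\<in>staircase n. Max (T c))"
    "place T1 \<in> excited (staircase (n + 2 * k)) (staircase n) \<Longrightarrow>
      place T \<in> excited (staircase (n + 2 * k)) (staircase n)"
proof -
  have "\<exists>c. c \<in> staircase n \<and> T c \<noteq> {0}"
  proof (rule ccontr)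
    assume "\<nexists>c. c \<in> staircase n \<and> T c \<noteq> {0}"
    then have "T c = svt0 n c" for c
      using svt_outside[OF T, of c] by (cases c) (auto simp: svt0_def)
    then show False using ne by blast
  qed
  then obtain i j where c: "(i, j) \<in> staircase n" "T (i, j) \<noteq> {0}"
    and least: "\<And>i' j'. (i', j') \<in> staircase n \<Longrightarrow> i' + j' < i + j \<Longrightarrow> T (i', j') = {0}"
    using ex_has_least_nat[of "\<lambda>c. c \<in> staircase n \<and> T c \<noteq> {0}" _ "\<lambda>(i, j). i + j"]
    by (metis (mono_tags, lifting) case_prod_conv not_le surj_pair)
  have zero: "b = 0" if "b \<in> T (i', j')" "i' + j' < i + j" for i' j' b
    using least[of i' j'] that svt_outside[OF T, of "(i', j')"] by fastforce
  define M where "M = Max (T (i, j))"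
  have ne: "T (i, j) \<noteq> {}" and sub: "T (i, j) \<subseteq> {..k}" using svt_inside[OF T c(1)] by blast+
  then have fin: "finite (T (i, j))" using finite_subset by blast
  have M: "M \<in> T (i, j)" and Mge: "\<And>b. b \<in> T (i, j) \<Longrightarrow> b \<le> M"
    unfolding M_def using fin ne by auto
  have "M \<noteq> 0"
  proof
    assume "M = 0"
    then have "T (i, j) = {0}" using M Mge by fastforce
    then show False using c by simp
  qed
  then obtain a where a: "M = Suc a" using not0_implies_Suc by blast
  have ij: "1 \<le> i" "1 \<le> j" "i + j \<le> n" using c(1) staircase_iff by blast+
  have Mk: "M \<le> k" using svt_le[OF T M] .
  have out: "x \<le> b" if "x \<in> insert a (T (i, j))" "b \<in> T (Suc i, j) \<union> T (i, Suc j)" for x b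
  proof -
    have "M \<le> b" using that(2) svt_down[OF T M] svt_right[OF T M] by blast
    then show ?thesis using that(1) Mge[of x] a by auto
  qed
  have inn: "b \<le> x" if "b \<in> T (i', j')" "(Suc i', j') = (i, j) \<or> (i', Suc j') = (i, j)" for x b i' j'
    using zero[OF that(1)] that(2) by auto
  define T1 where "T1 = T((i, j) := insert a (T (i, j)) - {M})"
  define T2 where "T2 = T((i, j) := insert a (T (i, j)))"
  have T1: "T1 \<in> svt n k" unfolding T1_def
    by (rule svt_update[OF T]) (use ij Mk sub out inn a in auto)
  have T2: "T2 \<in> svt n k" unfolding T2_def
    by (rule svt_update[OF T]) (use ij Mk sub out inn a in auto)
  have aT1: "a \<in> T1 (i, j)" and MT1: "M \<notin> T1 (i, j)" using a by (auto simp: T1_def)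
  \<comment> \<open>A neighbour in the diagram would have a base cell either nearer to the origin,
    where the entry 0 cannot carry it this far, or to the south-east of \<open>(i, j)\<close>, where
    an entry at most \<open>a\<close> would contradict \<open>svt_mono\<close> applied to
    \<open>M\<close>.\<close>
  have free: "(i + a + d, j + a + e) \<notin> place T1" if de: "d \<le> 1" "e \<le> 1" "0 < d + e" for d e
  proof
    assume "(i + a + d, j + a + e) \<in> place T1"
    then obtain i' j' b where b: "b \<in> T1 (i', j')" "i + a + d = i' + b" "j + a + e = j' + b"
      unfolding place_iff by blast
    show False
    proof (cases "(i', j') = (i, j)")
      case True
      then have "b = M" using b a de by auto
      then show False using b(1) True MT1 by simp
    next
      case False
      then have bT: "b \<in> T (i', j')" using b(1) unfolding T1_def by (metis fun_upd_other)
      show False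
      proof (cases "i' + j' < i + j")
        case True
        then show False using zero[OF bT] b by linarith
      next
        case F: False
        have "b \<noteq> Suc a" using b de F False by auto
        then have "b \<le> a" using b de F by linarith
        then have "i' = i + (a - b + d)" "j' = j + (a - b + e)" using b by auto
        then have "b \<in> T (i + (a - b + d), j + (a - b + e))" using bT by simp
        moreover have "0 < (a - b + d) + (a - b + e)" using de by linarith
        ultimately have "M \<le> b" by (rule svt_mono[OF T M])
        then show False using \<open>b \<le> a\<close> a by simp
      qed
    qed
  qed
  have act: "active (staircase (n + 2 * k)) (place T1) (i + a, j + a)"
    using place_mem[of a T1 i j] aT1 free[of 1 0] free[of 0 1] free[of 1 1] ij Mk a
    by (auto simp: active_def staircase_iff)
  have "T2 = T1((i, j) := insert M (T1 (i, j)))"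
  proof -
    have "insert a (T (i, j)) = insert M (insert a (T (i, j)) - {M})" using M by blast
    then show ?thesis unfolding T1_def T2_def by simp
  qed
  then have p2: "place T2 = insert (i + a + 1, j + a + 1) (place T1)"
    using place_insert[of T1 i j M] a by simp
  have "place T \<in> excited (staircase (n + 2 * k)) (staircase n)"
    if ex: "place T1 \<in> excited (staircase (n + 2 * k)) (staircase n)"
  \<comment> \<open>If the lowered value was already present, \<open>T1\<close> merely lost
    \<open>M\<close>, and a type II move restores it; otherwise \<open>M\<close> was replaced by
    \<open>a\<close>, and a type I move swaps it back.\<close>
  proof (cases "a \<in> T (i, j)")
    case True
    then have "T2 = T" unfolding T2_def by (simp add: insert_absorb)
    then show ?thesis using excited.typeII[OF ex act] p2 by simp
  next
    case False
    then have "T = T2((i, j) := T2 (i, j) - {a})" unfolding T2_def by simp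
    then have "place T = place T2 - {(i + a, j + a)}"
      using place_remove[OF T2, of a i j] by (simp add: T2_def)
    then have "place T = insert (i + a + 1, j + a + 1) (place T1 - {(i + a, j + a)})"
      using p2 by auto
    then show ?thesis using excited.typeI[OF ex act] by simp
  qed
  moreover have "(\<Sum>c\<in>staircase n. Max (T1 c)) < (\<Sum>c\<in>staircase n. Max (T c))"
  proof (rule sum_strict_mono_ex1[OF finite_staircase])
    have "x \<le> a" if "x \<in> T1 (i, j)" for x
    proof -
      have "x \<noteq> M" "x \<le> M" using that Mge[of x] a unfolding T1_def by auto
      then show ?thesis using a by simp
    qed
    then have "Max (T1 (i, j)) < Max (T (i, j))"
      using fin aT1 a unfolding M_def[symmetric] T1_def
      by (subst Max_less_iff) (auto simp: less_Suc_eq_le)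
    then show "\<forall>c\<in>staircase n. Max (T1 c) \<le> Max (T c)"
      "\<exists>c\<in>staircase n. Max (T1 c) < Max (T c)"
      using c(1) unfolding T1_def by (auto simp del: fun_upd_same simp: less_imp_le)
  qed
  ultimately show ?thesis using that T1 by blast
qed

lemma place_in_excited:
  "T \<in> svt n k \<Longrightarrow> place T \<in> excited (staircase (n + 2 * k)) (staircase n)"
proof (induction "\<Sum>c\<in>staircase n. Max (T c)" arbitrary: T rule: less_induct)
  case less
  show ?case
  proof (cases "T = svt0 n")
    case True
    then show ?thesis using svt0(2) excited.base by metis
  next
    case False
    then show ?thesis using place_unstep[OF less.prems] less.hyps by metis
  qed
qed

lemma card_excited: "card (excited (staircase (n + 2 * k)) (staircase n)) = card (svt n k)"
proof -
  have "excited (staircase (n + 2 * k)) (staircase n) = place ` svt n k"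
    using excited_imp_place place_in_excited by auto
  then show ?thesis using card_image[OF place_inj] by simp
qed

section \<open>Toggling antidiagonals\<close>

text \<open>Reverse plane partitions of staircase shape, extended by \<open>0\<close> on the axes and by \<open>k\<close> beyond the
  staircase, so that every cell has four neighbours. The axes take precedence outside the staircase.\<close>

definition rpp :: "nat \<Rightarrow> nat \<Rightarrow> (nat \<Rightarrow> nat \<Rightarrow> nat) set" where
  "rpp n k = {t. \<forall>i j. (i = 0 \<or> j = 0 \<longrightarrow> t i j = 0) \<and> (1 \<le> i \<and> 1 \<le> j \<and> n < i + j \<longrightarrow> t i j = k) \<and>
     t i j \<le> t (Suc i) j \<and> t i j \<le> t i (Suc j)}"

lemma rpp_zero: "t \<in> rpp n k \<Longrightarrow> t 0 j = 0 \<and> t i 0 = 0"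
  and rpp_outside: "t \<in> rpp n k \<Longrightarrow> 1 \<le> i \<Longrightarrow> 1 \<le> j \<Longrightarrow> n < i + j \<Longrightarrow> t i j = k"
  and rpp_mono: "t \<in> rpp n k \<Longrightarrow> t i j \<le> t (Suc i) j \<and> t i j \<le> t i (Suc j)"
  unfolding rpp_def by auto

lemma rpp_pred: "t \<in> rpp n k \<Longrightarrow> t (i - 1) j \<le> t i j \<and> t i (j - 1) \<le> t i j"
  using rpp_mono[of t n k "i - 1" j] rpp_mono[of t n k i "j - 1"] by (cases i; cases j) auto

text \<open>The entry is reflected in the interval between its larger predecessor and its smaller
  successor. Cells of one antidiagonal are never adjacent, so they can all be reflected at
  once.\<close>

definition toggle :: "nat \<Rightarrow> (nat \<Rightarrow> nat \<Rightarrow> nat) \<Rightarrow> nat \<Rightarrow> nat \<Rightarrow> nat" where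
  "toggle r t i j = (if 1 \<le> i \<and> 1 \<le> j \<and> i + j = r
     then max (t (i - 1) j) (t i (j - 1)) + min (t (Suc i) j) (t i (Suc j)) - t i j else t i j)"

definition antisum :: "nat \<Rightarrow> (nat \<Rightarrow> nat \<Rightarrow> nat) \<Rightarrow> int" where
  "antisum s t = (\<Sum>i\<le>s. int (t i (s - i)))"

text \<open>For \<open>t \<in> rpp n k\<close>, \<open>minsum s t - antisum s t\<close> is the part
  of the exponent that belongs to antidiagonal \<open>s\<close>; its two axis cells contribute 0 to
  both sums.\<close>

definition minsum :: "nat \<Rightarrow> (nat \<Rightarrow> nat \<Rightarrow> nat) \<Rightarrow> int" where
  "minsum s t = (\<Sum>i\<le>s. int (min (t (Suc i) (s - i)) (t i (Suc (s - i)))))"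

fun altsum :: "nat \<Rightarrow> (nat \<Rightarrow> nat \<Rightarrow> nat) \<Rightarrow> int" where
  "altsum 0 t = 0"
| "altsum (Suc s) t = antisum (Suc s) t - altsum s t"

lemma toggle_on: "1 \<le> i \<Longrightarrow> 1 \<le> j \<Longrightarrow> i + j = r \<Longrightarrow> toggle r t i j =
    max (t (i - 1) j) (t i (j - 1)) + min (t (Suc i) j) (t i (Suc j)) - t i j"
  and toggle_off: "\<not> (1 \<le> i \<and> 1 \<le> j \<and> i + j = r) \<Longrightarrow> toggle r t i j = t i j"
  and toggle_other: "i + j \<noteq> r \<Longrightarrow> toggle r t i j = t i j"
  unfolding toggle_def by meson+

lemma toggle_bounds:
  assumes t: "t \<in> rpp n k" and "1 \<le> i" "1 \<le> j" "i + j = r"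
  shows "max (t (i - 1) j) (t i (j - 1)) \<le> toggle r t i j"
    "toggle r t i j \<le> min (t (Suc i) j) (t i (Suc j))"
  using rpp_mono[OF t, of i j] rpp_pred[OF t, of i j] assms by (auto simp: toggle_def)


lemma toggle_rpp:
  assumes t: "t \<in> rpp n k" and r: "r \<le> n"
  shows "toggle r t \<in> rpp n k"
  unfolding rpp_def
proof (intro CollectI allI conjI impI)
  fix i j
  show "i = 0 \<or> j = 0 \<Longrightarrow> toggle r t i j = 0"
    using rpp_zero[OF t] by (auto simp: toggle_def)
  show "1 \<le> i \<and> 1 \<le> j \<and> n < i + j \<Longrightarrow> toggle r t i j = k"
    using rpp_outside[OF t] r by (auto simp: toggle_def)
  have *: "toggle r t i j \<le> toggle r t i' j'"
    if h: "(i', j') = (Suc i, j) \<or> (i', j') = (i, Suc j)" for i' j'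
  proof -
    have sum: "i' + j' = Suc (i + j)" using h by auto
    have le: "t i j \<le> t i' j'" using h rpp_mono[OF t] by auto
    consider "1 \<le> i" "1 \<le> j" "i + j = r" | "1 \<le> i'" "1 \<le> j'" "i' + j' = r"
      | "toggle r t i j = t i j" "toggle r t i' j' = t i' j'"
      using toggle_off[of i j r t] toggle_off[of i' j' r t] by argo
    then show ?thesis
    proof cases
      case 1
      then have "i' + j' \<noteq> r" using sum by linarith
      then have eq: "toggle r t i' j' = t i' j'" by (rule toggle_other)
      have "toggle r t i j \<le> min (t (Suc i) j) (t i (Suc j))" by (rule toggle_bounds(2)[OF t 1])
      also have "\<dots> \<le> t i' j'" using h by auto
      finally show ?thesis unfolding eq .
    next
      case 2
      then have "i + j \<noteq> r" using sum by linarith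
      then have eq: "toggle r t i j = t i j" by (rule toggle_other)
      have "t i j \<le> max (t (i' - 1) j') (t i' (j' - 1))" using h by auto
      also have "\<dots> \<le> toggle r t i' j'" by (rule toggle_bounds(1)[OF t 2])
      finally show ?thesis unfolding eq .
    next
      case 3
      then show ?thesis using le by simp
    qed
  qed
  show "toggle r t i j \<le> toggle r t (Suc i) j" "toggle r t i j \<le> toggle r t i (Suc j)"
    using * by blast+
qed

lemma toggle_toggle:
  assumes t: "t \<in> rpp n k"
  shows "toggle r (toggle r t) = t"
proof (intro ext)
  fix i j
  show "toggle r (toggle r t) i j = t i j"
  proof (cases "1 \<le> i \<and> 1 \<le> j \<and> i + j = r")
    case True
    then have nb: "toggle r t (i - 1) j = t (i - 1) j" "toggle r t i (j - 1) = t i (j - 1)"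
      "toggle r t (Suc i) j = t (Suc i) j" "toggle r t i (Suc j) = t i (Suc j)"
      by (intro toggle_other; linarith)+
    define lo hi where "lo = max (t (i - 1) j) (t i (j - 1))" and "hi = min (t (Suc i) j) (t i (Suc j))"
    have "t i j \<le> hi" using rpp_mono[OF t] by (simp add: hi_def)
    moreover have "toggle r t i j = lo + hi - t i j"
      unfolding lo_def hi_def using True by (intro toggle_on) blast+
    moreover have "toggle r (toggle r t) i j = lo + hi - toggle r t i j"
      unfolding lo_def hi_def nb[symmetric] using True by (intro toggle_on) blast+
    ultimately show ?thesis by linarith
  next
    case False
    then show ?thesis by (simp only: toggle_off if_False not_False_eq_True)
  qed
qed

lemma toggle_bij:
  assumes "r \<le> n"
  shows "bij_betw (toggle r) (rpp n k) (rpp n k)"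
  by (rule bij_betw_byWitness[where f' = "toggle r"]) (use assms toggle_rpp toggle_toggle in blast)+

section \<open>Effect of a toggle on the exponents\<close>

lemma altsum_cong: "(\<And>i j. i + j \<le> s \<Longrightarrow> t i j = t' i j) \<Longrightarrow> altsum s t = altsum s t'"
proof (induction s)
  case (Suc s)
  have "antisum (Suc s) t = antisum (Suc s) t'" unfolding antisum_def
    by (rule sum.cong) (use Suc.prems in auto)
  then show ?case using Suc by simp
qed simp

lemma minsum_cong: "(\<And>i j. i + j = Suc s \<Longrightarrow> t i j = t' i j) \<Longrightarrow> minsum s t = minsum s t'"
  unfolding minsum_def by (rule sum.cong) auto

text \<open>The maxima of adjacent entries of an antidiagonal and the minima of adjacent entries add up to
  twice the sum of that antidiagonal, because it starts and ends with 0.\<close>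

lemma antisum_toggle:
  assumes t: "t \<in> rpp n k"
  shows "antisum (s + 2) (toggle (s + 2) t) =
    2 * antisum (s + 1) t - minsum s t + minsum (s + 2) t - antisum (s + 2) t"
proof -
  note z = rpp_zero[OF t]
  define g where "g i = int (max (t (i - 1) (s + 2 - i)) (t i (s + 2 - i - 1)))" for i
  have "int (toggle (s + 2) t i (s + 2 - i)) + int (t i (s + 2 - i)) =
      g i + int (min (t (Suc i) (s + 2 - i)) (t i (Suc (s + 2 - i))))" if i: "i \<le> s + 2" for i
  proof -
    consider "i = 0" | "i = s + 2" | "1 \<le> i" "1 \<le> s + 2 - i" using i by linarith
    then show ?thesis
    proof cases
      case 3
      have "t i (s + 2 - i) \<le> min (t (Suc i) (s + 2 - i)) (t i (Suc (s + 2 - i)))"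
        using rpp_mono[OF t] by simp
      then have "toggle (s + 2) t i (s + 2 - i) + t i (s + 2 - i) =
        max (t (i - 1) (s + 2 - i)) (t i (s + 2 - i - 1)) + min (t (Suc i) (s + 2 - i)) (t i (Suc (s + 2 - i)))"
        using 3 i by (subst toggle_on) (simp_all add: trans_le_add2 del: min.bounded_iff)
      then show ?thesis unfolding g_def by linarith
    qed (simp_all add: g_def toggle_def z)
  qed
  then have "antisum (s + 2) (toggle (s + 2) t) + antisum (s + 2) t = (\<Sum>i\<le>s + 2. g i) + minsum (s + 2) t"
    unfolding antisum_def minsum_def sum.distrib[symmetric] by (intro sum.cong) auto
  moreover have "(\<Sum>i\<le>s + 2. g i) = (\<Sum>i\<le>s. g (Suc i))"
  proof -
    have "(\<Sum>i\<le>s + 2. g i) = (\<Sum>i\<le>Suc s. g i) + g (s + 2)" by simp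
    also have "(\<Sum>i\<le>Suc s. g i) = g 0 + (\<Sum>i\<le>s. g (Suc i))" by (rule sum.atMost_Suc_shift)
    finally show ?thesis by (simp add: g_def z)
  qed
  moreover have "(\<Sum>i\<le>s. g (Suc i)) + minsum s t = 2 * antisum (s + 1) t"
  proof -
    have "(\<Sum>i\<le>s. g (Suc i)) + minsum s t = (\<Sum>i\<le>s. int (t i (s + 1 - i)) + int (t (Suc i) (s - i)))"
      unfolding minsum_def sum.distrib[symmetric]
    proof (intro sum.cong refl)
      fix i assume "i \<in> {..s}"
      then have "s + 2 - Suc i = s + 1 - i" "s + 2 - Suc i - 1 = s - i" "Suc (s - i) = s + 1 - i" by auto
      then show "g (Suc i) + int (min (t (Suc i) (s - i)) (t i (Suc (s - i)))) =
         int (t i (s + 1 - i)) + int (t (Suc i) (s - i))"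
        unfolding g_def by (simp add: max_def min_def)
    qed
    also have "\<dots> = (\<Sum>i\<le>s. int (t i (s + 1 - i))) + (\<Sum>i\<le>s. int (t (Suc i) (s + 1 - Suc i)))"
      by (simp add: sum.distrib)
    also have "(\<Sum>i\<le>s. int (t i (s + 1 - i))) = antisum (s + 1) t"
      unfolding antisum_def by (simp add: z)
    also have "(\<Sum>i\<le>s. int (t (Suc i) (s + 1 - Suc i))) = antisum (s + 1) t"
      unfolding antisum_def by (simp add: z sum.atMost_Suc_shift del: sum.atMost_Suc)
    finally show ?thesis by simp
  qed
  ultimately show ?thesis by linarith
qed

text \<open>A change of variables by the toggle of antidiagonal \<open>r = s + 2\<close>. By
  \<open>antisum_toggle\<close> the minima on antidiagonal \<open>r\<close> are exchanged for those
  on antidiagonal \<open>s\<close>, at the price of the linear term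
  \<open>antisum (s + 2) t - antisum (s + 1) t\<close>. This term involves only entries beyond
  \<open>s\<close>, so it can be absorbed into \<open>F\<close>, and the induction descends in steps
  of two.\<close>

lemma altsum_toggle_sum:
  fixes F :: "(nat \<Rightarrow> nat \<Rightarrow> nat) \<Rightarrow> real"
  assumes "r \<le> n" and "\<And>t t'. (\<And>i j. r < i + j \<Longrightarrow> t i j = t' i j) \<Longrightarrow> F t = F t'"
  shows "(\<Sum>t\<in>rpp n k. F t * 2 powi (minsum r t - antisum r t + altsum (r - 1) t)) =
    (\<Sum>t\<in>rpp n k. F t * 2 powi altsum r t)"
  using assms
proof (induction r arbitrary: F rule: less_induct)
  case (less r)
  consider "r = 0" | "r = 1" | s where "r = s + 2"
    by (metis One_nat_def Suc_1 add_2_eq_Suc' not0_implies_Suc)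
  then show ?case
  proof cases
    case 1
    have "minsum 0 t = 0" "antisum 0 t = 0" if "t \<in> rpp n k" for t
      using rpp_zero[OF that] by (auto simp: minsum_def antisum_def)
    then show ?thesis using 1 by (intro sum.cong) auto
  next
    case 2
    have "minsum 1 t = 0" "antisum 1 t = 0" if "t \<in> rpp n k" for t
      using rpp_zero[OF that] by (auto simp: minsum_def antisum_def)
    then show ?thesis using 2 by (intro sum.cong) auto
  next
    case (3 s)
    define G where "G t = F t * 2 powi (antisum (s + 2) t - antisum (s + 1) t)" for t
    have "(\<Sum>t\<in>rpp n k. F t * 2 powi (minsum r t - antisum r t + altsum (r - 1) t)) =
      (\<Sum>t\<in>rpp n k. F (toggle r t) * 2 powi (minsum r (toggle r t) - antisum r (toggle r t) + altsum (r - 1) (toggle r t)))"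
      by (rule sum.reindex_bij_betw[OF toggle_bij[OF less.prems(1)], symmetric])
    also have "\<dots> = (\<Sum>t\<in>rpp n k. G t * 2 powi (minsum s t - antisum s t + altsum (s - 1) t))"
    proof (rule sum.cong[OF refl])
      fix t assume t: "t \<in> rpp n k"
      have F: "F (toggle r t) = F t" by (rule less.prems(2)) (simp add: toggle_other)
      have m: "minsum r (toggle r t) = minsum r t" by (rule minsum_cong) (simp add: toggle_other)
      have a: "altsum (r - 1) (toggle r t) = altsum (s + 1) t"
        unfolding 3 by (simp only: add_2_eq_Suc' diff_Suc_1 Suc_eq_plus1[symmetric]) (rule altsum_cong, simp add: toggle_other)
      have s: "altsum s t = antisum s t - altsum (s - 1) t"
        using rpp_zero[OF t] by (cases s) (auto simp: antisum_def)
      have e: "minsum r (toggle r t) - antisum r (toggle r t) + altsum (r - 1) (toggle r t) =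
        (antisum (s + 2) t - antisum (s + 1) t) + (minsum s t - antisum s t + altsum (s - 1) t)"
        unfolding m a using antisum_toggle[OF t, of s] s 3 by simp
      show "F (toggle r t) * 2 powi (minsum r (toggle r t) - antisum r (toggle r t) + altsum (r - 1) (toggle r t)) =
        G t * 2 powi (minsum s t - antisum s t + altsum (s - 1) t)"
        unfolding e F G_def by (simp add: power_int_add mult.assoc)
    qed
    also have "\<dots> = (\<Sum>t\<in>rpp n k. G t * 2 powi altsum s t)"
    proof (rule less.IH)
      fix t t' :: "nat \<Rightarrow> nat \<Rightarrow> nat" assume eq: "\<And>i j. s < i + j \<Longrightarrow> t i j = t' i j"
      then have "F t = F t'" using 3 by (intro less.prems(2)) auto
      moreover have "antisum (s + 2) t = antisum (s + 2) t'" "antisum (s + 1) t = antisum (s + 1) t'"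
        unfolding antisum_def by (intro sum.cong; use eq in simp)+
      ultimately show "G t = G t'" unfolding G_def by simp
    qed (use 3 less.prems in auto)
    also have "\<dots> = (\<Sum>t\<in>rpp n k. F t * 2 powi altsum r t)"
      unfolding G_def 3 by (intro sum.cong refl) (simp add: power_int_add[symmetric] mult.assoc algebra_simps)
    finally show ?thesis .
  qed
qed

text \<open>Antidiagonals are made linear from the inside outwards. When \<open>Suc r\<close> is
  reached, the inner part is already \<open>altsum r\<close>, and the outer factors involve only
  entries beyond \<open>Suc r\<close>, as \<open>altsum_toggle_sum\<close> demands.\<close>

lemma sum_rpp_altsum:
  "(\<Sum>t\<in>rpp n k. (2::real) powi (\<Sum>s\<in>{..n}. minsum s t - antisum s t)) =
    (\<Sum>t\<in>rpp n k. 2 powi altsum n t)"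
proof -
  have "r \<le> n \<Longrightarrow> (\<Sum>t\<in>rpp n k. (2::real) powi (\<Sum>s\<in>{..n}. minsum s t - antisum s t)) =
    (\<Sum>t\<in>rpp n k. 2 powi (\<Sum>s\<in>{r<..n}. minsum s t - antisum s t) * 2 powi altsum r t)" for r
  proof (induction r)
    case 0
    have "(\<Sum>s\<in>{..n}. minsum s t - antisum s t) = (\<Sum>s\<in>{0<..n}. minsum s t - antisum s t)" if "t \<in> rpp n k" for t
      using rpp_zero[OF that] by (intro sum.mono_neutral_right) (auto simp: minsum_def antisum_def)
    then show ?case by simp
  next
    case (Suc r)
    define F where "F t = (2::real) powi (\<Sum>s\<in>{Suc r<..n}. minsum s t - antisum s t)" for t
    have eq: "(2::real) powi (\<Sum>s\<in>{r<..n}. minsum s t - antisum s t) * 2 powi altsum r t =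
      F t * 2 powi (minsum (Suc r) t - antisum (Suc r) t + altsum (Suc r - 1) t)" for t
    proof -
      have "{r<..n} = insert (Suc r) {Suc r<..n}" using Suc.prems by auto
      then show ?thesis unfolding F_def by (simp add: power_int_add)
    qed
    have loc: "F t = F t'" if "\<And>i j. Suc r < i + j \<Longrightarrow> t i j = t' i j" for t t'
    proof -
      have "minsum s t = minsum s t'" "antisum s t = antisum s t'" if "Suc r < s" for s
        unfolding antisum_def using that \<open>\<And>i j. Suc r < i + j \<Longrightarrow> t i j = t' i j\<close>
        by (auto intro!: minsum_cong sum.cong)
      then have "(\<Sum>s\<in>{Suc r<..n}. minsum s t - antisum s t) = (\<Sum>s\<in>{Suc r<..n}. minsum s t' - antisum s t')"
        by (intro sum.cong) auto
      then show ?thesis unfolding F_def by (rule arg_cong)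
    qed
    have "(\<Sum>t\<in>rpp n k. 2 powi (\<Sum>s\<in>{r<..n}. minsum s t - antisum s t) * 2 powi altsum r t) =
        (\<Sum>t\<in>rpp n k. F t * 2 powi altsum (Suc r) t)"
      unfolding eq by (rule altsum_toggle_sum[OF Suc.prems loc])
    then show ?case using Suc.IH Suc.prems unfolding F_def by linarith
  qed
  from this[of n] show ?thesis by simp
qed

section \<open>Grouping by minima\<close>

lemma bij_betw_default_PiE:
  "bij_betw (\<lambda>T. restrict T A) {T. (\<forall>c. c \<notin> A \<longrightarrow> T c = d) \<and> (\<forall>c\<in>A. T c \<in> B c)} (PiE A B)"
  by (rule bij_betw_byWitness[where f' = "\<lambda>f c. if c \<in> A then f c else d"])
    (auto simp: fun_eq_iff PiE_def extensional_def)

lemma card_default_functions: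
  "finite A \<Longrightarrow> card {T. (\<forall>c. c \<notin> A \<longrightarrow> T c = d) \<and> (\<forall>c\<in>A. T c \<in> B c)} = (\<Prod>c\<in>A. card (B c))"
  using bij_betw_same_card[OF bij_betw_default_PiE[of A d B]] by (simp add: card_PiE)

lemma finite_default_functions:
  "finite A \<Longrightarrow> (\<And>c. c \<in> A \<Longrightarrow> finite (B c)) \<Longrightarrow>
    finite {T. (\<forall>c. c \<notin> A \<longrightarrow> T c = d) \<and> (\<forall>c\<in>A. T c \<in> B c)}"
  using bij_betw_finite[OF bij_betw_default_PiE[of A d B]] finite_PiE[of A B] by simp

lemma finite_svt: "finite (svt n k)"
proof -
  have "finite {T. (\<forall>c. c \<notin> staircase n \<longrightarrow> T c = {}) \<and> (\<forall>c\<in>staircase n. T c \<in> Pow {..k})}"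
    by (rule finite_default_functions) (auto simp: finite_staircase)
  then show ?thesis by (rule rev_finite_subset) (auto simp: svt_def)
qed

lemma card_subsets_with_min: "card {A. x \<in> A \<and> A \<subseteq> {x..m}} = 2 ^ (m - x)" if "x \<le> m" for x m :: nat
proof -
  have "bij_betw (insert x) (Pow {x<..m}) {A. x \<in> A \<and> A \<subseteq> {x..m}}"
    by (rule bij_betw_byWitness[where f' = "\<lambda>A. A - {x}"]) (use that in \<open>auto simp: subset_iff le_less\<close>)
  then have "card (Pow {x<..m}) = card {A. x \<in> A \<and> A \<subseteq> {x..m}}" by (rule bij_betw_same_card)
  then show ?thesis by (simp add: card_Pow)
qed

definition minmap :: "nat \<Rightarrow> nat \<Rightarrow> (nat \<times> nat \<Rightarrow> nat set) \<Rightarrow> nat \<Rightarrow> nat \<Rightarrow> nat" where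
  "minmap n k T i j = (if i = 0 \<or> j = 0 then 0 else if n < i + j then k else Min (T (i, j)))"

lemma minmap_mem:
  assumes T: "T \<in> svt n k" and ij: "(i, j) \<in> staircase n"
  shows "minmap n k T i j \<in> T (i, j)" "\<And>a. a \<in> T (i, j) \<Longrightarrow> minmap n k T i j \<le> a"
proof -
  have f: "finite (T (i, j))" "T (i, j) \<noteq> {}"
    using svt_inside[OF T ij] finite_subset[of "T (i, j)" "{..k}"] by auto
  have m: "minmap n k T i j = Min (T (i, j))" using ij by (auto simp: minmap_def staircase_iff)
  show "minmap n k T i j \<in> T (i, j)" unfolding m using f by simp
  show "minmap n k T i j \<le> a" if "a \<in> T (i, j)" for a unfolding m using f that by simp
qed

lemma minmap_upper:
  assumes T: "T \<in> svt n k" and a: "a \<in> T (i, j)"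
  shows "a \<le> minmap n k T (Suc i) j" "a \<le> minmap n k T i (Suc j)"
proof -
  note cell = svt_cell[OF T a] and ak = svt_le[OF T a]
  show "a \<le> minmap n k T (Suc i) j"
  proof (cases "(Suc i, j) \<in> staircase n")
    case True
    then show ?thesis using svt_down[OF T a] minmap_mem(1)[OF T True] by blast
  next
    case False
    then show ?thesis using cell ak by (auto simp: minmap_def staircase_iff)
  qed
  show "a \<le> minmap n k T i (Suc j)"
  proof (cases "(i, Suc j) \<in> staircase n")
    case True
    then show ?thesis using svt_right[OF T a] minmap_mem(1)[OF T True] by blast
  next
    case False
    then show ?thesis using cell ak by (auto simp: minmap_def staircase_iff)
  qed
qed

lemma minmap_rpp:
  assumes T: "T \<in> svt n k"
  shows "minmap n k T \<in> rpp n k"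
proof -
  have "minmap n k T i j \<le> minmap n k T (Suc i) j \<and> minmap n k T i j \<le> minmap n k T i (Suc j)" for i j
  proof (cases "(i, j) \<in> staircase n")
    case True
    then show ?thesis using minmap_upper[OF T minmap_mem(1)[OF T True]] by blast
  next
    case False
    then show ?thesis by (auto simp: minmap_def staircase_iff)
  qed
  moreover have "minmap n k T i j = 0" if "i = 0 \<or> j = 0" for i j using that by (auto simp: minmap_def)
  moreover have "minmap n k T i j = k" if "1 \<le> i \<and> 1 \<le> j \<and> n < i + j" for i j
    using that by (auto simp: minmap_def)
  ultimately show ?thesis unfolding rpp_def
    by (intro CollectI allI conjI impI) simp_all
qed

lemma rpp_le:
  assumes t: "t \<in> rpp n k"
  shows "t i j \<le> k"
proof (cases "j = 0")
  case False
  have "t i j \<le> t (i + d) j" for d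
  proof (induction d)
    case (Suc d)
    then show ?case using rpp_mono[OF t, of "i + d" j] by simp
  qed simp
  from this[of "Suc n"] show ?thesis using rpp_outside[OF t, of "i + Suc n" j] False by simp
qed (simp add: rpp_zero[OF t])

text \<open>Once all minima are prescribed, the order condition compares the elements of a set only
  with the known minima of its neighbours, so the sets at different cells can be chosen
  independently.\<close>

lemma minmap_fiber:
  assumes t: "t \<in> rpp n k"
  shows "{T \<in> svt n k. minmap n k T = t} = {T. (\<forall>c. c \<notin> staircase n \<longrightarrow> T c = {}) \<and>
    (\<forall>c\<in>staircase n. T c \<in> (case c of (i, j) \<Rightarrow> {A. t i j \<in> A \<and> A \<subseteq> {t i j..min (t (Suc i) j) (t i (Suc j))}}))}"
    (is "?L = ?R")
proof (intro equalityI subsetI)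
  fix T assume "T \<in> ?L"
  then have T: "T \<in> svt n k" and m: "minmap n k T = t" by blast+
  have "t i j \<in> T (i, j) \<and> T (i, j) \<subseteq> {t i j..min (t (Suc i) j) (t i (Suc j))}"
    if "(i, j) \<in> staircase n" for i j
    using minmap_mem[OF T that] minmap_upper[OF T] unfolding m by (simp add: subset_iff)
  then show "T \<in> ?R" using svt_outside[OF T] by auto
next
  fix T assume T: "T \<in> ?R"
  then have out: "\<And>c. c \<notin> staircase n \<Longrightarrow> T c = {}"
    and mem: "\<And>i j. (i, j) \<in> staircase n \<Longrightarrow> t i j \<in> T (i, j)"
    and bd: "\<And>i j a. (i, j) \<in> staircase n \<Longrightarrow> a \<in> T (i, j) \<Longrightarrow> t i j \<le> a \<and> a \<le> t (Suc i) j \<and> a \<le> t i (Suc j)"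
    by fastforce+
  have "T c \<noteq> {} \<and> T c \<subseteq> {..k}" if "c \<in> staircase n" for c
  proof (cases c)
    case (Pair i j)
    then show ?thesis using mem[of i j] bd[of i j] rpp_le[OF t] that order_trans by blast
  qed
  moreover have "a \<le> b" if "a \<in> T (i, j)" "b \<in> T (Suc i, j) \<union> T (i, Suc j)" for i j a b
  proof -
    have "a \<le> t (Suc i) j" "a \<le> t i (Suc j)" using bd that(1) out by blast+
    moreover have "t (Suc i) j \<le> b \<or> t i (Suc j) \<le> b" using bd that(2) out by blast
    ultimately show ?thesis by linarith
  qed
  ultimately have svt: "T \<in> svt n k" using out unfolding svt_def by blast
  have "minmap n k T i j = t i j" for i j
  proof (cases "(i, j) \<in> staircase n")
    case True
    then show ?thesis using minmap_mem[OF svt True] mem bd by (meson order_antisym)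
  next
    case False
    then show ?thesis using rpp_zero[OF t] rpp_outside[OF t] by (auto simp: minmap_def staircase_iff)
  qed
  then show "T \<in> ?L" using svt by blast
qed

lemma minmap_image: "minmap n k ` svt n k = rpp n k"
proof (intro equalityI subsetI)
  fix t assume t: "t \<in> rpp n k"
  define T where "T c = (if c \<in> staircase n then {case c of (i, j) \<Rightarrow> t i j} else {})" for c
  have "T \<in> {T \<in> svt n k. minmap n k T = t}"
    unfolding minmap_fiber[OF t] using rpp_mono[OF t] by (auto simp: T_def)
  then show "t \<in> minmap n k ` svt n k" by blast
qed (use minmap_rpp in blast)

lemma sum_staircase_antidiagonals:
  assumes "\<And>i j. i = 0 \<or> j = 0 \<Longrightarrow> f i j = (0::int)"
  shows "(\<Sum>(i, j)\<in>staircase n. f i j) = (\<Sum>s\<le>n. \<Sum>i\<le>s. f i (s - i))"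
proof -
  have "(\<Sum>s\<le>n. \<Sum>i\<le>s. f i (s - i)) = (\<Sum>(s, i)\<in>(SIGMA s:{..n}. {..s}). f i (s - i))"
    by (subst sum.Sigma) auto
  also have "\<dots> = (\<Sum>(i, j)\<in>staircase n. f i j)"
    by (rule sum.reindex_bij_witness_not_neutral[where S' = "{(s, i) \<in> (SIGMA s:{..n}. {..s}). i = 0 \<or> i = s}"
        and T' = "{}" and j = "\<lambda>(s, i). (i, s - i)" and i = "\<lambda>(i, j). (i + j, i)"])
      (auto simp: staircase_def assms intro: finite_subset[of _ "SIGMA s:{..n}. {..s}"])
  finally show ?thesis by simp
qed

lemma card_svt: "real (card (svt n k)) = (\<Sum>t\<in>rpp n k. 2 powi (\<Sum>s\<in>{..n}. minsum s t - antisum s t))"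
proof -
  have "real (card {T \<in> svt n k. minmap n k T = t}) = 2 powi (\<Sum>s\<in>{..n}. minsum s t - antisum s t)"
    if t: "t \<in> rpp n k" for t
  proof -
    define f where "f i j = min (t (Suc i) j) (t i (Suc j)) - t i j" for i j
    have le: "t i j \<le> min (t (Suc i) j) (t i (Suc j))" for i j using rpp_mono[OF t] by simp
    have "card {T \<in> svt n k. minmap n k T = t} = (\<Prod>(i, j)\<in>staircase n. 2 ^ f i j)"
      unfolding minmap_fiber[OF t] f_def
      by (subst card_default_functions[OF finite_staircase], rule prod.cong)
        (use card_subsets_with_min[OF le] in auto)
    also have "\<dots> = 2 ^ (\<Sum>(i, j)\<in>staircase n. f i j)"
      by (simp add: power_sum case_prod_unfold)
    finally have "real (card {T \<in> svt n k. minmap n k T = t}) = 2 powi (\<Sum>(i, j)\<in>staircase n. int (f i j))"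
      by (simp add: case_prod_unfold flip: of_nat_sum)
    also have "(\<Sum>(i, j)\<in>staircase n. int (f i j)) = (\<Sum>s\<le>n. \<Sum>i\<le>s. int (f i (s - i)))"
      by (rule sum_staircase_antidiagonals) (use rpp_zero[OF t] in \<open>auto simp: f_def\<close>)
    also have "\<dots> = (\<Sum>s\<in>{..n}. minsum s t - antisum s t)"
      unfolding minsum_def antisum_def sum_subtractf[symmetric] f_def
      by (intro sum.cong refl) (use of_nat_diff[OF le] in simp)
    finally show ?thesis .
  qed
  then show ?thesis
    using sum.image_gen[OF finite_svt, of "\<lambda>_. 1::real" n k "minmap n k"]
    by (simp add: minmap_image cong: sum.cong)
qed

section \<open>Little Schroeder numbers and weighted Dyck paths\<close>

text \<open>Index \<open>j\<close> stands for height \<open>2 * j\<close> at even times and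
  \<open>2 * j + 1\<close> at odd times; \<open>i\<close> is the starting index at time 0. Thus from
  an even time a step up keeps the index and a step down lowers it, while from an odd time a step
  down keeps it and a step up, of weight 2, raises it.\<close>

fun halfwalk :: "nat \<Rightarrow> nat \<Rightarrow> nat \<Rightarrow> real" where
  "halfwalk 0 i j = (if i = j then 1 else 0)"
| "halfwalk (Suc x) i j = (if even x then halfwalk x i j + halfwalk x i (Suc j)
     else halfwalk x i j + (if j = 0 then 0 else 2 * halfwalk x i (j - 1)))"

definition walk :: "nat \<Rightarrow> nat \<Rightarrow> nat \<Rightarrow> real" where
  "walk n i j = halfwalk (2 * n) i j"

lemma walk_0: "walk 0 i j = (if i = j then 1 else 0)"
  by (simp add: walk_def)

lemma walk_Suc_0: "walk (Suc n) i 0 = walk n i 0 + walk n i (Suc 0)"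
  by (simp add: walk_def)

lemma walk_Suc_Suc:
  "walk (Suc n) i (Suc j) = 2 * walk n i j + 3 * walk n i (Suc j) + walk n i (Suc (Suc j))"
  by (simp add: walk_def)

text \<open>A matrix commutes with its powers, so a factor \<open>walk 1\<close> can be split off at
  the starting index as well as at the final one. The right factor of the Hankel matrix needs this
  form.\<close>

lemma walk_left_0: "walk (Suc n) 0 j = walk n 0 j + 2 * walk n (Suc 0) j"
proof (induction n arbitrary: j)
  case 0
  then show ?case by (cases j) (auto simp: walk_0 walk_Suc_0 walk_Suc_Suc)
next
  case (Suc n)
  show ?case
  proof (cases j)
    case 0
    then show ?thesis
      using walk_Suc_0[of "Suc n" 0] walk_Suc_0[of n 0] walk_Suc_0[of n "Suc 0"]
        Suc.IH[of 0] Suc.IH[of "Suc 0"] by simp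
  next
    case (Suc m)
    then show ?thesis
      using walk_Suc_Suc[of "Suc n" 0 m] walk_Suc_Suc[of n 0 m] walk_Suc_Suc[of n "Suc 0" m]
        Suc.IH[of m] Suc.IH[of "Suc m"] Suc.IH[of "Suc (Suc m)"] by simp
  qed
qed

lemma walk_left_Suc:
  "walk (Suc n) (Suc i) j = walk n i j + 3 * walk n (Suc i) j + 2 * walk n (Suc (Suc i)) j"
proof (induction n arbitrary: j)
  case 0
  then show ?case by (cases j) (auto simp: walk_0 walk_Suc_0 walk_Suc_Suc)
next
  case (Suc n)
  show ?case
  proof (cases j)
    case 0
    then show ?thesis
      using walk_Suc_0[of "Suc n" "Suc i"] walk_Suc_0[of n i] walk_Suc_0[of n "Suc i"]
        walk_Suc_0[of n "Suc (Suc i)"] Suc.IH[of 0] Suc.IH[of "Suc 0"] by simp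
  next
    case (Suc m)
    then show ?thesis
      using walk_Suc_Suc[of "Suc n" "Suc i" m] walk_Suc_Suc[of n i m] walk_Suc_Suc[of n "Suc i" m]
        walk_Suc_Suc[of n "Suc (Suc i)" m] Suc.IH[of m] Suc.IH[of "Suc m"]
        Suc.IH[of "Suc (Suc m)"] by simp
  qed
qed

section \<open>Triangular factors of the Hankel matrix\<close>

lemma walk_above: "i + n < j \<Longrightarrow> walk n i j = 0"
proof (induction n arbitrary: j)
  case (Suc n)
  then obtain j' where "j = Suc j'" by (cases j) auto
  then show ?case using Suc by (simp add: walk_Suc_Suc)
qed (simp add: walk_0)

lemma walk_below: "j + n < i \<Longrightarrow> walk n i j = 0"
proof (induction n arbitrary: i)
  case (Suc n)
  then obtain i' where "i = Suc i'" by (cases i) auto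
  then show ?case using Suc by (simp add: walk_left_Suc)
qed (simp add: walk_0)

lemma walk_diag_up: "walk n 0 n = 2 ^ n"
  by (induction n) (simp_all add: walk_0 walk_Suc_Suc walk_above)

lemma walk_diag_down: "walk n n 0 = 1"
  by (induction n) (simp_all add: walk_0 walk_left_Suc walk_below)

text \<open>Matrix multiplication cut off at \<open>k\<close>: starting from index 0,
  \<open>a\<close> steps reach no index above \<open>a\<close>, so the omitted terms vanish.\<close>

lemma walk_split_left:
  assumes "a < k"
  shows "walk (n + a) 0 j = (\<Sum>i<k. walk a 0 i * walk n i j)"
proof (induction n arbitrary: j)
  case 0
  show ?case
  proof (cases "j < k")
    case True
    have "(\<Sum>i<k. walk a 0 i * walk 0 i j) = (\<Sum>i<k. if i = j then walk a 0 j else 0)"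
      by (intro sum.cong) (auto simp: walk_0)
    then show ?thesis using True by (simp add: sum.delta)
  next
    case False
    then show ?thesis using assms by (simp add: walk_0 walk_above)
  qed
next
  case (Suc n)
  then show ?case
    by (cases j) (simp_all add: walk_Suc_0 walk_Suc_Suc algebra_simps sum.distrib sum_distrib_left)
qed

lemma walk_split_right:
  assumes "b < k"
  shows "walk (n + b) i 0 = (\<Sum>j<k. walk n i j * walk b j 0)"
proof (induction n arbitrary: i)
  case 0
  show ?case
  proof (cases "i < k")
    case True
    have "(\<Sum>j<k. walk 0 i j * walk b j 0) = (\<Sum>j<k. if i = j then walk b i 0 else 0)"
      by (intro sum.cong) (auto simp: walk_0)
    then show ?thesis using True by (simp add: sum.delta)
  next
    case False
    then show ?thesis using assms by (simp add: walk_0 walk_below)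
  qed
next
  case (Suc n)
  then show ?case
    by (cases i) (simp_all add: walk_left_0 walk_left_Suc algebra_simps sum.distrib sum_distrib_left)
qed

lemma hankel_walk:
  assumes "a < k" "b < k"
  shows "walk (n + a + b) 0 0 = (\<Sum>i<k. walk a 0 i * (\<Sum>j<k. walk n i j * walk b j 0))"
proof -
  have "walk (n + a + b) 0 0 = walk (n + b + a) 0 0" by (simp add: ac_simps)
  then show ?thesis using walk_split_left[OF assms(1), of "n + b" 0] walk_split_right[OF assms(2), of n] by simp
qed

lemma prod_two_powers: "(\<Prod>a = 0..<k. (2::real) ^ a) = 2 ^ (k choose 2)"
  by (induction k) (simp_all add: numeral_2_eq_2 power_add)

lemma det_hankel_walk:
  "det (mat k k (\<lambda>(a, b). walk (n + a + b) 0 0)) = 2 ^ (k choose 2) * det (mat k k (\<lambda>(i, j). walk n i j))"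
proof -
  define L where "L = mat k k (\<lambda>(a, i). walk a 0 i)"
  define N where "N = mat k k (\<lambda>(i, j). walk n i j)"
  define R where "R = mat k k (\<lambda>(j, b). walk b j 0)"
  have c: "L \<in> carrier_mat k k" "N \<in> carrier_mat k k" "R \<in> carrier_mat k k"
    by (simp_all add: L_def N_def R_def)
  have "mat k k (\<lambda>(a, b). walk (n + a + b) 0 0) = L * (N * R)"
    by (rule eq_matI) (simp_all add: L_def N_def R_def scalar_prod_def hankel_walk lessThan_atLeast0)
  moreover have "det L = 2 ^ (k choose 2)"
  proof -
    have "det L = prod_list (diag_mat L)"
      by (rule det_lower_triangular[OF _ c(1)]) (simp add: L_def walk_above)
    also have "\<dots> = (\<Prod>a = 0..<k. 2 ^ a)"
      by (simp add: prod_list_diag_prod L_def walk_diag_up)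
    finally show ?thesis by (simp add: prod_two_powers)
  qed
  moreover have "det R = 1"
  proof -
    have "det R = prod_list (diag_mat R)"
      by (rule det_upper_triangular[OF _ c(3)]) (auto simp: R_def walk_below)
    also have "\<dots> = 1" by (simp add: prod_list_diag_prod R_def walk_diag_down)
    finally show ?thesis .
  qed
  ultimately show ?thesis
    using det_mult[OF c(1) mult_carrier_mat[OF c(2,3)]] det_mult[OF c(2,3)] by (simp add: N_def)
qed

section \<open>Schroeder paths sorted by their final height above the diagonal\<close>

definition spaths :: "nat \<Rightarrow> nat \<Rightarrow> step list set" where
  "spaths x h = {ps. pos ps (length ps) = (int x, int (x + h)) \<and>
     (\<forall>t \<le> length ps. fst (pos ps t) \<le> snd (pos ps t)) \<and>
     (\<forall>t < length ps. ps ! t = StepD \<longrightarrow> fst (pos ps t) \<noteq> snd (pos ps t))}"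

lemma little_schroeder_spaths: "little_schroeder m = card (spaths m 0)"
  by (simp add: little_schroeder_def spaths_def schroeder_path_def)

lemma pos_snoc: "t \<le> length ps \<Longrightarrow> pos (ps @ [s]) t = pos ps t"
  by (simp add: pos_def)

lemma pos_snoc_end: "pos (ps @ [s]) (Suc (length ps)) =
    (fst (pos ps (length ps)) + step_dx s, snd (pos ps (length ps)) + step_dy s)"
  by (simp add: pos_def)

text \<open>A diagonal step preserves the height, so the ban on starting it from the diagonal
  becomes the condition \<open>0 < h\<close> on the end point.\<close>

lemma snoc_in_spaths: "ps @ [s] \<in> spaths x h \<longleftrightarrow>
    pos ps (length ps) = (int x - step_dx s, int (x + h) - step_dy s) \<and>
    (\<forall>t \<le> length ps. fst (pos ps t) \<le> snd (pos ps t)) \<and>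
    (\<forall>t < length ps. ps ! t = StepD \<longrightarrow> fst (pos ps t) \<noteq> snd (pos ps t)) \<and>
    (s = StepD \<longrightarrow> 0 < h)"
proof -
  have le: "(\<forall>t \<le> length (ps @ [s]). P t) \<longleftrightarrow> (\<forall>t \<le> length ps. P t) \<and> P (Suc (length ps))" for P
    by (auto simp: le_Suc_eq)
  have lt: "(\<forall>t < length (ps @ [s]). P t) \<longleftrightarrow> (\<forall>t < length ps. P t) \<and> P (length ps)" for P
    by (auto simp: less_Suc_eq)
  show ?thesis
    unfolding spaths_def mem_Collect_eq le lt
    by (cases s; cases "pos ps (length ps)") (auto simp: pos_snoc pos_snoc_end nth_append)
qed

lemma pos_nonneg: "0 \<le> fst (pos ps t)" "0 \<le> snd (pos ps t)"
proof -
  have "0 \<le> sum_list (map step_dx qs) \<and> 0 \<le> sum_list (map step_dy qs)" for qs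
  proof (induction qs)
    case (Cons s qs)
    then show ?case by (cases s) auto
  qed simp
  then show "0 \<le> fst (pos ps t)" "0 \<le> snd (pos ps t)" by (simp_all add: pos_def)
qed

lemma Nil_in_spaths: "[] \<in> spaths x h \<longleftrightarrow> x = 0 \<and> h = 0"
  by (auto simp: spaths_def pos_def)

lemma snoc_cases:
  "ps @ [StepE] \<in> spaths x h \<longleftrightarrow> 0 < x \<and> ps \<in> spaths (x - 1) (Suc h)"
  "ps @ [StepN] \<in> spaths x h \<longleftrightarrow> 0 < h \<and> ps \<in> spaths x (h - 1)"
  "ps @ [StepD] \<in> spaths x h \<longleftrightarrow> 0 < x \<and> 0 < h \<and> ps \<in> spaths (x - 1) h"
proof -
  note nn = pos_nonneg[of ps "length ps"]
  show "ps @ [StepE] \<in> spaths x h \<longleftrightarrow> 0 < x \<and> ps \<in> spaths (x - 1) (Suc h)"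
    unfolding snoc_in_spaths using nn by (cases x) (auto simp: spaths_def)
  show "ps @ [StepN] \<in> spaths x h \<longleftrightarrow> 0 < h \<and> ps \<in> spaths x (h - 1)"
    unfolding snoc_in_spaths using nn by (cases h) (auto simp: spaths_def)
  show "ps @ [StepD] \<in> spaths x h \<longleftrightarrow> 0 < x \<and> 0 < h \<and> ps \<in> spaths (x - 1) h"
    unfolding snoc_in_spaths using nn by (cases x) (auto simp: spaths_def)
qed

lemma spaths_eq:
  "spaths x h = (if x = 0 \<and> h = 0 then {[]} else {}) \<union>
    (if 0 < x then (\<lambda>ps. ps @ [StepE]) ` spaths (x - 1) (Suc h) else {}) \<union>
    (if 0 < h then (\<lambda>ps. ps @ [StepN]) ` spaths x (h - 1) else {}) \<union>
    (if 0 < x \<and> 0 < h then (\<lambda>ps. ps @ [StepD]) ` spaths (x - 1) h else {})"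
proof -
  have "ps \<in> spaths x h \<longleftrightarrow> ps = [] \<and> x = 0 \<and> h = 0 \<or>
     (\<exists>qs. ps = qs @ [StepE] \<and> 0 < x \<and> qs \<in> spaths (x - 1) (Suc h)) \<or>
     (\<exists>qs. ps = qs @ [StepN] \<and> 0 < h \<and> qs \<in> spaths x (h - 1)) \<or>
     (\<exists>qs. ps = qs @ [StepD] \<and> 0 < x \<and> 0 < h \<and> qs \<in> spaths (x - 1) h)" for ps
  proof (cases ps rule: rev_cases)
    case Nil
    then show ?thesis by (simp add: Nil_in_spaths)
  next
    case (snoc qs s)
    then show ?thesis by (cases s) (simp_all only: snoc_cases append1_eq_conv step.distinct, auto)
  qed
  then show ?thesis by (auto simp: set_eq_iff)
qed

fun npaths :: "nat \<Rightarrow> nat \<Rightarrow> nat" where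
  "npaths 0 0 = 1"
| "npaths 0 (Suc h) = npaths 0 h"
| "npaths (Suc x) 0 = npaths x 1"
| "npaths (Suc x) (Suc h) = npaths x (Suc (Suc h)) + npaths (Suc x) h + npaths x (Suc h)"

lemma card_spaths: "finite (spaths x h) \<and> card (spaths x h) = npaths x h"
proof (induction x h rule: npaths.induct)
  case 1
  then show ?case by (subst (1 2) spaths_eq) simp
next
  case (2 h)
  then show ?case by (subst (1 2) spaths_eq) (simp add: card_image inj_on_def)
next
  case (3 x)
  then show ?case by (subst (1 2) spaths_eq) (simp add: card_image inj_on_def)
next
  case (4 x h)
  have "card (((\<lambda>ps. ps @ [StepE]) ` A \<union> (\<lambda>ps. ps @ [StepN]) ` B) \<union> (\<lambda>ps. ps @ [StepD]) ` C) =
      card A + card B + card C" if "finite A" "finite B" "finite C" for A B C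
    using that by (subst card_Un_disjoint; (subst card_Un_disjoint)?) (auto simp: card_image inj_on_def)
  then show ?case using 4 by (subst (1 2) spaths_eq) simp
qed

lemma sum_choose_Suc:
  "(\<Sum>j\<le>n. p j * real (Suc h choose j)) =
    (\<Sum>j\<le>n. p j * real (h choose j)) + (\<Sum>j<n. p (Suc j) * real (h choose j))"
  by (induction n) (simp_all add: algebra_simps)

text \<open>By Pascal's rule, raising \<open>h\<close> by one acts on the coefficients like a half
  step of \<open>halfwalk\<close> from an even time; the vanishing of \<open>p (Suc n)\<close>
  removes the boundary term.\<close>

lemma sum_choose_Suc':
  assumes "p (Suc n) = 0"
  shows "(\<Sum>j\<le>n. p j * real (Suc h choose j)) = (\<Sum>j\<le>n. (p j + p (Suc j)) * real (h choose j))"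
proof -
  have "(\<Sum>j\<le>n. p (Suc j) * real (h choose j)) = (\<Sum>j<n. p (Suc j) * real (h choose j))"
    using assms by (simp add: lessThan_Suc_atMost[symmetric])
  then show ?thesis by (simp add: sum_choose_Suc distrib_right sum.distrib)
qed

text \<open>In the basis of binomial coefficients \<open>h choose j\<close>, appending an east or diagonal step followed
  by north steps acts by the same three-term recurrence as \<open>walk\<close>.\<close>

lemma npaths_walk: "real (npaths n h) = (\<Sum>j\<le>n. walk n 0 j * real (h choose j))"
proof (induction n h rule: npaths.induct)
  case 1
  then show ?case by (simp add: walk_0)
next
  case (2 h)
  then show ?case by (simp add: walk_0)
next
  case (3 n)
  have "(\<Sum>j\<le>n. walk n 0 j * real (1 choose j)) = walk n 0 0 + walk n 0 (Suc 0)"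
  proof (cases n)
    case 0
    then show ?thesis by (simp add: walk_0)
  next
    case (Suc m)
    have "(\<Sum>j\<le>m. walk n 0 (Suc j) * real (1 choose (Suc j))) = (\<Sum>j\<in>{0}. walk n 0 (Suc j) * real (1 choose (Suc j)))"
      by (rule sum.mono_neutral_right) auto
    then show ?thesis using Suc by (simp add: sum.atMost_Suc_shift del: sum.atMost_Suc)
  qed
  moreover have "(\<Sum>j\<le>Suc n. walk (Suc n) 0 j * real (0 choose j)) = walk (Suc n) 0 0"
    by (simp add: sum.atMost_Suc_shift del: sum.atMost_Suc)
  ultimately show ?case using 3 by (simp add: walk_Suc_0 del: sum.atMost_Suc)
next
  case (4 n h)
  define p where "p = walk n 0"
  have z: "p (Suc n) = 0" "p (Suc (Suc n)) = 0" "walk (Suc n) 0 (Suc (Suc n)) = 0"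
    unfolding p_def by (simp_all add: walk_above)
  have "(\<Sum>j\<le>Suc n. walk (Suc n) 0 j * real (Suc h choose j)) =
     (\<Sum>j\<le>Suc n. walk (Suc n) 0 j * real (h choose j)) + (\<Sum>j\<le>n. walk (Suc n) 0 (Suc j) * real (h choose j))"
    by (simp only: sum_choose_Suc lessThan_Suc_atMost)
  \<comment> \<open>The recurrence coefficients 2, 3, 1 split as one plus two applications of the
    operator \<open>p j + p (Suc j)\<close>. One application raises \<open>h\<close> by 1 and
    accounts for a final diagonal step, two raise it by 2 and account for a final east step.\<close>
  also have "(\<Sum>j\<le>n. walk (Suc n) 0 (Suc j) * real (h choose j)) =
      (\<Sum>j\<le>n. (p j + p (Suc j)) * real (h choose j)) +
      (\<Sum>j\<le>n. ((p j + p (Suc j)) + (p (Suc j) + p (Suc (Suc j)))) * real (h choose j))"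
    unfolding sum.distrib[symmetric] by (intro sum.cong) (auto simp: p_def walk_Suc_Suc algebra_simps)
  also have "(\<Sum>j\<le>n. (p j + p (Suc j)) * real (h choose j)) = (\<Sum>j\<le>n. p j * real (Suc h choose j))"
    using sum_choose_Suc'[of p n h] z by simp
  also have "(\<Sum>j\<le>n. ((p j + p (Suc j)) + (p (Suc j) + p (Suc (Suc j)))) * real (h choose j)) =
      (\<Sum>j\<le>n. p j * real (Suc (Suc h) choose j))"
    using sum_choose_Suc'[of p n "Suc h"] sum_choose_Suc'[of "\<lambda>j. p j + p (Suc j)" n h] z by simp
  finally show ?case using 4 by (simp add: p_def del: sum.atMost_Suc binomial_Suc_Suc)
qed

lemma little_schroeder_walk: "real (little_schroeder n) = walk n 0 0"
proof -
  have "(\<Sum>j\<le>n. walk n 0 j * real (0 choose j)) = (\<Sum>j\<in>{0}. walk n 0 j * real (0 choose j))"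
    by (rule sum.mono_neutral_right) auto
  then show ?thesis using npaths_walk[of n 0] by (simp add: little_schroeder_spaths card_spaths)
qed

section \<open>Minors as sums over nonintersecting paths\<close>

definition rowdet :: "nat \<Rightarrow> (nat \<Rightarrow> nat \<Rightarrow> real) \<Rightarrow> real" where
  "rowdet k A = det (mat k k (\<lambda>(r, i). A r i))"

lemma rowdet_eq:
  "rowdet k A = (\<Sum>p | p permutes {0..<k}. signof p * (\<Prod>r = 0..<k. A r (p r)))"
proof -
  have "(\<Prod>r = 0..<k. mat k k (\<lambda>(r, i). A r i) $$ (r, p r)) = (\<Prod>r = 0..<k. A r (p r))"
    if "p permutes {0..<k}" for p
    by (rule prod.cong) (use permutes_in_image[OF that] in auto)
  then show ?thesis unfolding rowdet_def by (subst det_def'[of _ k]) auto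
qed

lemma rowdet_cong: "(\<And>r i. r < k \<Longrightarrow> i < k \<Longrightarrow> A r i = B r i) \<Longrightarrow> rowdet k A = rowdet k B"
  unfolding rowdet_def by (intro arg_cong[of _ _ det] eq_matI) auto

text \<open>Multilinearity in all rows at once: \<open>E\<close> is the set of rows that take the
  first summand. In the transfer steps it is the set of paths whose index changes.\<close>

lemma rowdet_add:
  "rowdet k (\<lambda>r i. A r i + B r i) = (\<Sum>E\<in>Pow {0..<k}. rowdet k (\<lambda>r. if r \<in> E then A r else B r))"
proof -
  have "(\<Prod>r = 0..<k. A r (p r) + B r (p r)) =
      (\<Sum>E\<in>Pow {0..<k}. \<Prod>r = 0..<k. (if r \<in> E then A r else B r) (p r))" for p
  proof -
    have "(\<Prod>r = 0..<k. A r (p r) + B r (p r)) =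
        (\<Sum>E\<in>Pow {0..<k}. (\<Prod>r\<in>E. A r (p r)) * (\<Prod>r\<in>{0..<k} - E. B r (p r)))"
      by (rule prod_add) simp
    also have "\<dots> = (\<Sum>E\<in>Pow {0..<k}. \<Prod>r = 0..<k. (if r \<in> E then A r else B r) (p r))"
    proof (rule sum.cong[OF refl])
      fix E assume "E \<in> Pow {0..<k}"
      then have "(\<Prod>r = 0..<k. (if r \<in> E then A r else B r) (p r)) =
          (\<Prod>r\<in>{0..<k} - E. (if r \<in> E then A r else B r) (p r)) * (\<Prod>r\<in>E. (if r \<in> E then A r else B r) (p r))"
        by (intro prod.subset_diff) auto
      also have "\<dots> = (\<Prod>r\<in>E. A r (p r)) * (\<Prod>r\<in>{0..<k} - E. B r (p r))"
        by (subst mult.commute, intro arg_cong2[of _ _ _ _ "(*)"] prod.cong) auto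
      finally show "(\<Prod>r\<in>E. A r (p r)) * (\<Prod>r\<in>{0..<k} - E. B r (p r)) =
        (\<Prod>r = 0..<k. (if r \<in> E then A r else B r) (p r))" by simp
    qed
    finally show ?thesis .
  qed
  then show ?thesis
    unfolding rowdet_eq by (simp only: sum_distrib_left) (rule sum.swap)
qed

lemma rowdet_scale: "rowdet k (\<lambda>r i. c r * A r i) = (\<Prod>r = 0..<k. c r) * rowdet k A"
  unfolding rowdet_eq by (simp add: prod.distrib sum_distrib_left mult_ac)

lemma rowdet_zero_row:
  assumes "r < k" "\<And>i. i < k \<Longrightarrow> A r i = 0"
  shows "rowdet k A = 0"
proof -
  have "(\<Prod>r = 0..<k. A r (p r)) = 0" if "p permutes {0..<k}" for p
    using permutes_in_image[OF that, of r] assms by (intro prod_zero bexI[of _ r]) auto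
  then show ?thesis unfolding rowdet_eq by (simp add: sum.neutral)
qed

lemma rowdet_equal_rows:
  assumes "r < k" "s < k" "r \<noteq> s" "\<And>i. i < k \<Longrightarrow> A r i = A s i"
  shows "rowdet k A = 0"
  unfolding rowdet_def
  by (rule det_identical_rows[of _ k r s]) (use assms in \<open>auto intro!: eq_vecI\<close>)

section \<open>Transfer of minors through one half step\<close>

definition parts :: "nat \<Rightarrow> (nat \<Rightarrow> nat) set" where
  "parts k = {u. (\<forall>r\<ge>k. u r = 0) \<and> (\<forall>r. Suc r < k \<longrightarrow> u r \<le> u (Suc r))}"

text \<open>The offsets \<open>u\<close> are measured from the packed end indices
  \<open>0, ..., k - 1\<close>; for \<open>u \<in> parts k\<close> the indices
  \<open>r + u r\<close> strictly increase, which is nonintersection. End indices label the rows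
  because the recursion of \<open>halfwalk\<close> acts on its last argument.\<close>

definition minor :: "nat \<Rightarrow> nat \<Rightarrow> (nat \<Rightarrow> nat) \<Rightarrow> real" where
  "minor k x u = rowdet k (\<lambda>r i. halfwalk x i (r + u r))"

definition trans_step :: "nat \<Rightarrow> nat \<Rightarrow> (nat \<Rightarrow> nat) \<Rightarrow> (nat \<Rightarrow> nat) \<Rightarrow> bool" where
  "trans_step k x u v \<longleftrightarrow> (\<forall>r<k. if even x then u r = v r \<or> u r = Suc (v r) else v r = u r \<or> v r = Suc (u r))"

definition preds :: "nat \<Rightarrow> nat \<Rightarrow> (nat \<Rightarrow> nat) \<Rightarrow> (nat \<Rightarrow> nat) set" where
  "preds k x v = {u \<in> parts k. trans_step k x u v}"

text \<open>Along a \<open>trans_step\<close> from an odd time this is the number of paths taking a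
  step of weight 2. As a difference of sums it can later be matched with differences of diagonal
  sums.\<close>

definition gain :: "nat \<Rightarrow> nat \<Rightarrow> (nat \<Rightarrow> nat) \<Rightarrow> (nat \<Rightarrow> nat) \<Rightarrow> int" where
  "gain k x u v = (if even x then 0 else (\<Sum>r<k. int (v r) - int (u r)))"

lemma parts_mono:
  assumes "u \<in> parts k" "r \<le> s" "s < k"
  shows "u r \<le> u s"
  using assms(2,3)
proof (induction s rule: dec_induct)
  case (step s)
  then show ?case using assms(1) by (auto simp: parts_def intro: order_trans)
qed simp

lemma minor_0:
  assumes u: "u \<in> parts k"
  shows "minor k 0 u = (if u = (\<lambda>_. 0) then 1 else 0)"
proof (cases "u = (\<lambda>_. 0)")
  case True
  have "mat k k (\<lambda>(r, i). halfwalk 0 i (r + u r)) = 1\<^sub>m k" using True by (intro eq_matI) auto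
  then show ?thesis using True by (simp add: minor_def rowdet_def)
next
  case False
  then obtain r where r: "u r \<noteq> 0" by auto
  then have rk: "r < k" using u unfolding parts_def by (metis (mono_tags, lifting) mem_Collect_eq not_le)
  \<comment> \<open>The last row then has index at least \<open>k\<close>, which lies outside the
    columns of the identity, so this row is zero.\<close>
  then have "u r \<le> u (k - 1)" using parts_mono[OF u, of r "k - 1"] by simp
  then have "rowdet k (\<lambda>r i. halfwalk 0 i (r + u r)) = 0"
    by (intro rowdet_zero_row[of "k - 1"]) (use r rk in auto)
  then show ?thesis using False by (simp add: minor_def)
qed

text \<open>Expanding every row by the recurrence of \<open>halfwalk\<close> gives one minor for each set \<open>E\<close> of shifted
  rows; the minors whose row indices are not strictly increasing vanish.\<close>

lemma minor_Suc_even: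
  assumes x: "even x" and v: "v \<in> parts k"
  shows "minor k (Suc x) v = (\<Sum>u\<in>preds k x v. minor k x u)"
proof -
  define up where "up E r = (if r \<in> E then Suc (v r) else v r)" for E r
  have "minor k (Suc x) v = rowdet k (\<lambda>r i. halfwalk x i (r + Suc (v r)) + halfwalk x i (r + v r))"
    unfolding minor_def by (rule rowdet_cong) (simp add: x)
  also have "\<dots> = (\<Sum>E\<in>Pow {0..<k}. minor k x (up E))"
    unfolding rowdet_add minor_def by (intro sum.cong rowdet_cong) (auto simp: up_def)
  also have "\<dots> = (\<Sum>E | E \<subseteq> {0..<k} \<and> up E \<in> parts k. minor k x (up E))"
  proof (rule sum.mono_neutral_right)
    show "\<forall>E\<in>Pow {0..<k} - {E. E \<subseteq> {0..<k} \<and> up E \<in> parts k}. minor k x (up E) = 0"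
    proof
      fix E assume "E \<in> Pow {0..<k} - {E. E \<subseteq> {0..<k} \<and> up E \<in> parts k}"
      then have E: "E \<subseteq> {0..<k}" "up E \<notin> parts k" by auto
      have "up E r = 0" if "k \<le> r" for r using that E(1) v by (auto simp: up_def parts_def)
      then obtain r where r: "Suc r < k" "\<not> up E r \<le> up E (Suc r)"
        using E(2) by (auto simp: parts_def)
      moreover have "v r \<le> v (Suc r)" using v r(1) by (simp add: parts_def)
      ultimately have "r + up E r = Suc r + up E (Suc r)"
        by (auto simp: up_def split: if_splits)
      then show "minor k x (up E) = 0"
        unfolding minor_def by (intro rowdet_equal_rows[of r k "Suc r"]) (use r(1) in auto)
    qed
  qed auto
  also have "\<dots> = (\<Sum>u\<in>preds k x v. minor k x u)"
  proof (rule sum.reindex_bij_betw)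
    show "bij_betw up {E. E \<subseteq> {0..<k} \<and> up E \<in> parts k} (preds k x v)"
    proof (rule bij_betw_byWitness[where f' = "\<lambda>u. {r. r < k \<and> u r \<noteq> v r}"])
      show "\<forall>u\<in>preds k x v. up {r. r < k \<and> u r \<noteq> v r} = u"
        using x v by (auto simp: preds_def up_def trans_step_def parts_def fun_eq_iff)
      then show "(\<lambda>u. {r. r < k \<and> u r \<noteq> v r}) ` preds k x v \<subseteq> {E. E \<subseteq> {0..<k} \<and> up E \<in> parts k}"
        by (auto simp: preds_def)
    qed (use x in \<open>auto simp: preds_def up_def trans_step_def\<close>)
  qed
  finally show ?thesis .
qed

lemma minor_Suc_odd:
  assumes x: "odd x" and v: "v \<in> parts k"
  shows "minor k (Suc x) v = (\<Sum>u\<in>preds k x v. 2 powi gain k x u v * minor k x u)"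
proof -
  define dn where "dn E r = (if r \<in> E then v r - 1 else v r)" for E r
  define A where "A r i = (if r + v r = 0 then 0 else halfwalk x i (r + v r - 1))" for r i
  define B where "B r i = halfwalk x i (r + v r)" for r i
  define M where "M E = rowdet k (\<lambda>r. if r \<in> E then A r else B r)" for E
  define good where "good = {E. E \<subseteq> {0..<k} \<and> (\<forall>r\<in>E. v r \<noteq> 0) \<and> dn E \<in> parts k}"
  have "minor k (Suc x) v = rowdet k (\<lambda>r i. 2 * A r i + B r i)"
    unfolding minor_def by (rule rowdet_cong) (use x in \<open>auto simp: A_def B_def\<close>)
  also have "\<dots> = (\<Sum>E\<in>Pow {0..<k}. 2 ^ card E * M E)"
    unfolding rowdet_add[of k "\<lambda>r i. 2 * A r i"]
  proof (rule sum.cong[OF refl])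
    fix E assume "E \<in> Pow {0..<k}"
    then have "(\<Prod>r = 0..<k. if r \<in> E then 2 else 1 :: real) = 2 ^ card E"
      by (subst prod.inter_restrict[symmetric]) (auto simp: Int_absorb1)
    moreover have "rowdet k (\<lambda>r. if r \<in> E then \<lambda>i. 2 * A r i else B r) =
        rowdet k (\<lambda>r i. (if r \<in> E then 2 else 1) * (if r \<in> E then A r else B r) i)"
      by (rule rowdet_cong) auto
    ultimately show "rowdet k (\<lambda>r. if r \<in> E then \<lambda>i. 2 * A r i else B r) = 2 ^ card E * M E"
      unfolding M_def rowdet_scale by simp
  qed
  also have "\<dots> = (\<Sum>E\<in>good. 2 ^ card E * M E)"
  proof (rule sum.mono_neutral_right)
    show "\<forall>E\<in>Pow {0..<k} - good. 2 ^ card E * M E = 0"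
    proof
      fix E assume "E \<in> Pow {0..<k} - good"
      then have E: "E \<subseteq> {0..<k}" "E \<notin> good" by auto
      have "M E = 0"
      proof (cases "\<forall>r\<in>E. v r \<noteq> 0")
        case False
        \<comment> \<open>A shifted row of offset 0 has no smaller offset available. For the first
          such row, either \<open>r = 0\<close> and the row is zero, or the preceding row also has
          offset 0, is unshifted by minimality, and has the same index \<open>r - 1\<close>.\<close>
        define r where "r = (LEAST r. r \<in> E \<and> v r = 0)"
        have r: "r \<in> E \<and> v r = 0"
          unfolding r_def by (rule LeastI_ex) (use False in auto)
        have least: "\<not> (s \<in> E \<and> v s = 0)" if "s < r" for s
          by (rule not_less_Least) (use that in \<open>simp add: r_def\<close>)
        have rk: "r < k" using r E by auto
        show ?thesis
        proof (cases r)
          case 0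
          then show ?thesis unfolding M_def using r rk by (intro rowdet_zero_row[of 0]) (auto simp: A_def)
        next
          case (Suc s)
          have "v s = 0" using parts_mono[OF v, of s r] r rk Suc by simp
          then show ?thesis unfolding M_def
            using r rk Suc least[of s] by (intro rowdet_equal_rows[of s k r]) (auto simp: A_def B_def)
        qed
      next
        case True
        have "dn E r = 0" if "k \<le> r" for r using that v by (auto simp: dn_def parts_def)
        then obtain r where r: "Suc r < k" "\<not> dn E r \<le> dn E (Suc r)"
          using E True by (auto simp: good_def parts_def)
        moreover have "v r \<le> v (Suc r)" using v r(1) by (simp add: parts_def)
        ultimately have "r \<notin> E" "Suc r \<in> E" "v (Suc r) = v r" by (auto simp: dn_def split: if_splits)
        then show ?thesis unfolding M_def
          using r(1) by (intro rowdet_equal_rows[of r k "Suc r"]) (auto simp: A_def B_def)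
      qed
      then show "2 ^ card E * M E = 0" by simp
    qed
  qed (auto simp: good_def)
  also have "\<dots> = (\<Sum>E\<in>good. 2 powi gain k x (dn E) v * minor k x (dn E))"
  proof (rule sum.cong[OF refl])
    fix E assume E: "E \<in> good"
    have "M E = minor k x (dn E)"
      unfolding M_def minor_def by (rule rowdet_cong) (use E in \<open>auto simp: good_def dn_def A_def B_def\<close>)
    moreover have "gain k x (dn E) v = int (card E)"
    proof -
      have "gain k x (dn E) v = (\<Sum>r<k. if r \<in> E then 1 else 0)"
        unfolding gain_def using x E by (auto intro!: sum.cong simp: dn_def good_def of_nat_diff Suc_le_eq)
      also have "\<dots> = int (card E)"
        using E by (subst sum.inter_restrict[symmetric]) (auto simp: good_def Int_absorb1 lessThan_atLeast0)
      finally show ?thesis .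
    qed
    ultimately show "2 ^ card E * M E = 2 powi gain k x (dn E) v * minor k x (dn E)" by simp
  qed
  also have "\<dots> = (\<Sum>u\<in>preds k x v. 2 powi gain k x u v * minor k x u)"
  proof (rule sum.reindex_bij_betw)
    show "bij_betw dn good (preds k x v)"
    proof (rule bij_betw_byWitness[where f' = "\<lambda>u. {r. r < k \<and> u r \<noteq> v r}"])
      show 1: "\<forall>u\<in>preds k x v. dn {r. r < k \<and> u r \<noteq> v r} = u"
        using x v by (auto simp: preds_def dn_def trans_step_def parts_def fun_eq_iff)
      show "(\<lambda>u. {r. r < k \<and> u r \<noteq> v r}) ` preds k x v \<subseteq> good"
        using 1 x by (auto simp: preds_def good_def trans_step_def)
    qed (use x in \<open>auto simp: preds_def good_def dn_def trans_step_def\<close>)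
  qed
  finally show ?thesis .
qed

lemma minor_Suc:
  "v \<in> parts k \<Longrightarrow> minor k (Suc x) v = (\<Sum>u\<in>preds k x v. 2 powi gain k x u v * minor k x u)"
  using minor_Suc_even[of x v k] minor_Suc_odd[of x v k] by (cases "even x") (simp_all add: gain_def)

definition fam :: "nat \<Rightarrow> nat \<Rightarrow> (nat \<Rightarrow> nat) \<Rightarrow> (nat \<Rightarrow> nat \<Rightarrow> nat) set" where
  "fam k N v = {l. l 0 = (\<lambda>_. 0) \<and> (\<forall>x<N. l x \<in> parts k \<and> trans_step k x (l x) (l (Suc x))) \<and>
     l N = v \<and> (\<forall>x>N. l x = (\<lambda>_. 0))}"

lemma fam_0: "fam k 0 v = (if v = (\<lambda>_. 0) then {\<lambda>_ _. 0} else {})"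
proof -
  have "l \<in> fam k 0 v \<longleftrightarrow> v = (\<lambda>_. 0) \<and> l = (\<lambda>_ _. 0)" for l
    by (auto simp: fam_def fun_eq_iff) (metis neq0_conv)
  then show ?thesis by auto
qed

lemma fam_Suc:
  assumes "v \<in> parts k"
  shows "bij_betw (\<lambda>(u, l). l(Suc N := v)) (SIGMA u:preds k N v. fam k N u) (fam k (Suc N) v)"
proof (rule bij_betw_byWitness[where f' = "\<lambda>l. (l N, l(Suc N := (\<lambda>_. 0)))"])
  show "\<forall>a\<in>SIGMA u:preds k N v. fam k N u.
      (\<lambda>l. (l N, l(Suc N := (\<lambda>_. 0)))) ((\<lambda>(u, l). l(Suc N := v)) a) = a"
    by (auto simp: fam_def fun_eq_iff)
  show "\<forall>l\<in>fam k (Suc N) v. (\<lambda>(u, l). l(Suc N := v)) (l N, l(Suc N := (\<lambda>_. 0))) = l"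
    by (auto simp: fam_def)
  show "(\<lambda>(u, l). l(Suc N := v)) ` (SIGMA u:preds k N v. fam k N u) \<subseteq> fam k (Suc N) v"
    by (auto simp: fam_def preds_def less_Suc_eq)
  show "(\<lambda>l. (l N, l(Suc N := (\<lambda>_. 0)))) ` fam k (Suc N) v \<subseteq> (SIGMA u:preds k N v. fam k N u)"
    by (auto simp: fam_def preds_def less_Suc_eq)
qed

lemma finite_preds: "finite (preds k x v)"
proof -
  have "preds k x v \<subseteq> {u. (\<forall>r. r \<notin> {..<k} \<longrightarrow> u r = 0) \<and> (\<forall>r\<in>{..<k}. u r \<in> {..Suc (v r)})}"
    by (auto simp: preds_def parts_def trans_step_def split: if_splits)
  moreover have "finite {u. (\<forall>r. r \<notin> {..<k} \<longrightarrow> u r = 0) \<and> (\<forall>r\<in>{..<k}. u r \<in> {..Suc (v r)})}"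
    by (rule finite_default_functions) auto
  ultimately show ?thesis by (rule finite_subset)
qed

text \<open>Iterating \<open>minor_Suc\<close> down to time 0, where only the packed configuration
  survives, gives the Lindstrom-Gessel-Viennot formula for these weights: all terms left are
  positive.\<close>

lemma minor_fam:
  "v \<in> parts k \<Longrightarrow> finite (fam k N v) \<and>
    minor k N v = (\<Sum>l\<in>fam k N v. 2 powi (\<Sum>x<N. gain k x (l x) (l (Suc x))))"
proof (induction N arbitrary: v)
  case 0
  then show ?case by (simp add: fam_0 minor_0)
next
  case (Suc N)
  let ?w = "\<lambda>N l. (2::real) powi (\<Sum>x<N. gain k x (l x) (l (Suc x)))"
  have IH: "finite (fam k N u)" "minor k N u = sum (?w N) (fam k N u)" if "u \<in> preds k N v" for u
    using Suc.IH that by (auto simp: preds_def)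
  have "minor k (Suc N) v = (\<Sum>u\<in>preds k N v. 2 powi gain k N u v * sum (?w N) (fam k N u))"
    unfolding minor_Suc[OF Suc.prems] using IH by simp
  also have "\<dots> = (\<Sum>(u, l)\<in>(SIGMA u:preds k N v. fam k N u). 2 powi gain k N u v * ?w N l)"
    unfolding sum_distrib_left using finite_preds IH by (intro sum.Sigma) auto
  also have "\<dots> = (\<Sum>a\<in>(SIGMA u:preds k N v. fam k N u). ?w (Suc N) ((\<lambda>(u, l). l(Suc N := v)) a))"
  proof (rule sum.cong[OF refl])
    fix a assume "a \<in> (SIGMA u:preds k N v. fam k N u)"
    then obtain u l where a: "a = (u, l)" "u = l N" by (auto simp: fam_def)
    have "(\<Sum>x<N. gain k x ((l(Suc N := v)) x) ((l(Suc N := v)) (Suc x))) = (\<Sum>x<N. gain k x (l x) (l (Suc x)))"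
      by (rule sum.cong) auto
    then show "(case a of (u, l) \<Rightarrow> 2 powi gain k N u v * ?w N l) = ?w (Suc N) ((\<lambda>(u, l). l(Suc N := v)) a)"
      unfolding a by (simp add: power_int_add mult.commute)
  qed
  also have "\<dots> = sum (?w (Suc N)) (fam k (Suc N) v)"
    by (rule sum.reindex_bij_betw[OF fam_Suc[OF Suc.prems]])
  moreover have "finite (fam k (Suc N) v)"
    using bij_betw_finite[OF fam_Suc[OF Suc.prems]] finite_preds IH by (metis finite_SigmaI)
  ultimately show ?case by simp
qed

section \<open>Diagonals of a filling and path families\<close>

text \<open>Column \<open>x\<close> of a filling is its diagonal \<open>j - i = x - n\<close>, listed from the outer boundary inwards;
  truncated subtraction sends the positions beyond the diagonal to cells with a zero coordinate.\<close>

definition column :: "nat \<Rightarrow> (nat \<Rightarrow> nat \<Rightarrow> nat) \<Rightarrow> nat \<Rightarrow> nat \<Rightarrow> nat" where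
  "column n t x p = t (n - Suc x div 2 - p) (x div 2 - p)"

text \<open>This is the conjugate of the partition on diagonal \<open>x\<close>, listed in
  increasing order: path \<open>r < k\<close> follows the boundary of the region of entries larger
  than \<open>k - Suc r\<close>.\<close>

definition levels :: "nat \<Rightarrow> nat \<Rightarrow> (nat \<Rightarrow> nat \<Rightarrow> nat) \<Rightarrow> nat \<Rightarrow> nat \<Rightarrow> nat" where
  "levels n k t x r = card {p. p < n \<and> r < k \<and> k - Suc r < column n t x p}"

text \<open>Conjugation back: inside the staircase, \<open>(i, j)\<close> is position
  \<open>(n - i - j) div 2\<close> on diagonal \<open>n + j - i\<close>, and its entry is the number
  of paths passing beyond that position.\<close>

definition unlevels :: "nat \<Rightarrow> nat \<Rightarrow> (nat \<Rightarrow> nat \<Rightarrow> nat) \<Rightarrow> nat \<Rightarrow> nat \<Rightarrow> nat" where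
  "unlevels n k l i j = (if i = 0 \<or> j = 0 then 0 else if n < i + j then k
     else card {q. q < k \<and> (n - i - j) div 2 < l (n + j - i) (k - Suc q)})"

text \<open>A downward closed set of naturals is an initial segment. Comparing a number with the
  size of the set is therefore testing membership, which reduces all inequalities about levels to
  inequalities about entries.\<close>

lemma less_card_downset:
  fixes Q :: "nat \<Rightarrow> bool"
  assumes "\<And>p. Q (Suc p) \<Longrightarrow> Q p"
  shows "p < card {p. p < m \<and> Q p} \<longleftrightarrow> p < m \<and> Q p"
proof -
  have down: "Q p" if "p \<le> p'" "Q p'" for p p'
    using that by (induction p' rule: dec_induct) (use assms in auto)
  have "\<exists>b. {p. p < m \<and> Q p} = {..<b}"
  proof (cases "\<exists>p. \<not> (p < m \<and> Q p)")
    case True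
    define b where "b = (LEAST p. \<not> (p < m \<and> Q p))"
    have "\<not> (b < m \<and> Q b)" unfolding b_def by (rule LeastI_ex) (rule True)
    moreover have "p < m \<and> Q p" if "p < b" for p using not_less_Least that unfolding b_def by blast
    ultimately have "{p. p < m \<and> Q p} = {..<b}" using down by (auto simp: not_less[symmetric])
    then show ?thesis by blast
  qed (meson less_irrefl)
  then obtain b where "{p. p < m \<and> Q p} = {..<b}" by blast
  then show ?thesis by (metis card_lessThan lessThan_iff mem_Collect_eq)
qed

lemma column_antimono:
  assumes t: "t \<in> rpp n k"
  shows "column n t x (Suc p) \<le> column n t x p"
proof -
  have "column n t x (Suc p) \<le> t (n - Suc x div 2 - p) (x div 2 - Suc p)"
    unfolding column_def using rpp_pred[OF t, of "n - Suc x div 2 - p" "x div 2 - Suc p"] by simp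
  also have "\<dots> \<le> column n t x p"
    unfolding column_def using rpp_pred[OF t, of "n - Suc x div 2 - p" "x div 2 - p"] by simp
  finally show ?thesis .
qed

lemma column_beyond: "t \<in> rpp n k \<Longrightarrow> n \<le> p \<Longrightarrow> column n t x p = 0"
  using rpp_zero[of t n k] by (simp add: column_def)

lemma less_levels:
  assumes t: "t \<in> rpp n k"
  shows "p < levels n k t x r \<longleftrightarrow> r < k \<and> k - Suc r < column n t x p"
proof -
  have "p < levels n k t x r \<longleftrightarrow> p < n \<and> r < k \<and> k - Suc r < column n t x p"
    unfolding levels_def by (rule less_card_downset) (use column_antimono[OF t] less_le_trans in blast)
  moreover have "\<not> k - Suc r < column n t x p" if "\<not> p < n" using column_beyond[OF t] that by simp
  ultimately show ?thesis by blast
qed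

lemma levels_parts:
  assumes t: "t \<in> rpp n k"
  shows "levels n k t x \<in> parts k"
proof -
  have "levels n k t x r \<le> levels n k t x (Suc r)" if "Suc r < k" for r
  proof (rule leI)
    show "\<not> levels n k t x (Suc r) < levels n k t x r"
      using less_levels[OF t, of "levels n k t x (Suc r)" x r]
        less_levels[OF t, of "levels n k t x (Suc r)" x "Suc r"] that by linarith
  qed
  moreover have "levels n k t x r = 0" if "k \<le> r" for r using that by (simp add: levels_def)
  ultimately show ?thesis by (simp add: parts_def)
qed

text \<open>Adjacent diagonals interlace. A diagonal with even \<open>x\<close> starts on
  antidiagonal \<open>n\<close> and one with odd \<open>x\<close> on antidiagonal
  \<open>n - 1\<close>, so the even one always dominates.\<close>

lemma rpp_column_step:
  assumes t: "t \<in> rpp n k"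
  shows "even x \<Longrightarrow> column n t (Suc x) p \<le> column n t x p \<and> column n t x (Suc p) \<le> column n t (Suc x) p"
    "odd x \<Longrightarrow> column n t x p \<le> column n t (Suc x) p \<and> column n t (Suc x) (Suc p) \<le> column n t x p"
proof -
  show "column n t (Suc x) p \<le> column n t x p \<and> column n t x (Suc p) \<le> column n t (Suc x) p" if e: "even x"
  proof -
    obtain y where x: "x = 2 * y" using e by (rule evenE)
    show ?thesis
      using rpp_pred[OF t, of "n - y - p" "y - p"] rpp_pred[OF t, of "n - Suc y - p" "y - p"]
      by (simp add: column_def x)
  qed
  show "column n t x p \<le> column n t (Suc x) p \<and> column n t (Suc x) (Suc p) \<le> column n t x p" if o: "odd x"
  proof -
    obtain y where x: "x = 2 * y + 1" using o by (rule oddE)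
    show ?thesis
      using rpp_pred[OF t, of "n - Suc y - p" "Suc y - p"] rpp_pred[OF t, of "n - Suc y - p" "y - p"]
      by (simp add: column_def x)
  qed
qed

lemma levels_step:
  assumes t: "t \<in> rpp n k"
  shows "trans_step k x (levels n k t x) (levels n k t (Suc x))"
proof -
  let ?l = "levels n k t"
  show ?thesis
  proof (cases "even x")
    case True
    have "\<not> ?l x r < ?l (Suc x) r" "\<not> Suc (?l (Suc x) r) < ?l x r" for r
      using less_levels[OF t, of "?l x r" "Suc x" r] less_levels[OF t, of "?l x r" x r]
        less_levels[OF t, of "Suc (?l (Suc x) r)" x r] less_levels[OF t, of "?l (Suc x) r" "Suc x" r]
        rpp_column_step(1)[OF t True, of "?l x r"] rpp_column_step(1)[OF t True, of "?l (Suc x) r"]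
      by linarith+
    then show ?thesis using True by (simp add: trans_step_def) (metis le_SucE not_le order_antisym)
  next
    case False
    have "\<not> ?l (Suc x) r < ?l x r" "\<not> Suc (?l x r) < ?l (Suc x) r" for r
      using less_levels[OF t, of "?l (Suc x) r" "Suc x" r] less_levels[OF t, of "?l (Suc x) r" x r]
        less_levels[OF t, of "Suc (?l x r)" "Suc x" r] less_levels[OF t, of "?l x r" x r]
        rpp_column_step(2)[OF t False, of "?l x r"] rpp_column_step(2)[OF t False, of "?l (Suc x) r"]
      by linarith+
    then show ?thesis using False by (simp add: trans_step_def) (metis le_SucE not_le order_antisym)
  qed
qed

lemma levels_fam:
  assumes t: "t \<in> rpp n k"
  shows "levels n k t \<in> fam k (2 * n) (\<lambda>_. 0)"
proof -
  have "levels n k t x = (\<lambda>_. 0)" if "x = 0 \<or> 2 * n \<le> x" for x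
  proof
    fix r
    have "column n t x p = 0" for p using that rpp_zero[OF t] by (auto simp: column_def)
    then show "levels n k t x r = 0" by (simp add: levels_def)
  qed
  then show ?thesis using levels_parts[OF t] levels_step[OF t] by (auto simp: fam_def)
qed

text \<open>Indices rise only from odd times, fall only from even times, and vanish at both ends.
  For \<open>x \<le> 2 * n\<close> the bounds count the odd times before \<open>x\<close> and the
  even times from \<open>x\<close> on.\<close>

lemma fam_bounds:
  assumes l: "l \<in> fam k (2 * n) (\<lambda>_. 0)"
  shows "r < k \<Longrightarrow> l x r \<le> x div 2" "r < k \<Longrightarrow> l x r \<le> n - Suc x div 2"
proof -
  have step: "trans_step k x (l x) (l (Suc x))" if "x < 2 * n" for x using l that by (simp add: fam_def)
  have out: "l x r = 0" if "2 * n \<le> x" for x r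
    using l that by (cases "x = 2 * n") (auto simp: fam_def)
  show "l x r \<le> x div 2" if r: "r < k"
  proof (induction x)
    case 0
    then show ?case using l by (simp add: fam_def)
  next
    case (Suc x)
    show ?case
    proof (cases "x < 2 * n")
      case True
      then show ?thesis using step[OF True] r Suc by (cases "even x") (auto simp: trans_step_def)
    next
      case False
      then show ?thesis using out by simp
    qed
  qed
  show "l x r \<le> n - Suc x div 2" if r: "r < k"
  proof (cases "x \<le> 2 * n")
    case True
    then show ?thesis
    proof (induction x rule: inc_induct)
      case base
      then show ?case using out by simp
    next
      case (step x)
      then show ?case using \<open>\<And>x. x < 2 * n \<Longrightarrow> trans_step k x (l x) (l (Suc x))\<close>[of x] r
        by (cases "even x") (auto simp: trans_step_def elim!: evenE oddE)
    qed
  next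
    case False
    then show ?thesis using out by simp
  qed
qed

section \<open>Diagonals of reverse plane partitions\<close>

lemma fam_parts:
  assumes "l \<in> fam k (2 * n) (\<lambda>_. 0)"
  shows "l x \<in> parts k"
  using assms by (cases x "2 * n" rule: linorder_cases) (auto simp: fam_def parts_def)

lemma cell_cases:
  fixes i j n :: nat
  assumes "i + j \<le> n"
  obtains p where "n = i + j + 2 * p" "(n - i - j) div 2 = p" "n + j - i = 2 * (j + p)"
  | p where "n = i + j + 2 * p + 1" "(n - i - j) div 2 = p" "n + j - i = 2 * (j + p) + 1"
proof -
  have d: "n = i + j + (n - i - j)"
    using assms by simp
  show ?thesis
  proof (cases "even (n - i - j)")
    case True
    then obtain p where "n - i - j = 2 * p" by (rule evenE)
    then show ?thesis using d by (intro that(1)[of p]) auto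
  next
    case False
    then obtain p where "n - i - j = 2 * p + 1" by (rule oddE)
    then show ?thesis using d by (intro that(2)[of p]) auto
  qed
qed

text \<open>The rounding in the two halvings agrees because \<open>n + j - i\<close> and
  \<open>n - i - j\<close> have the same parity.\<close>

lemma cell_position:
  assumes "1 \<le> i" "1 \<le> j" "i + j \<le> n"
  shows "n - Suc (n + j - i) div 2 - (n - i - j) div 2 = i"
    "(n + j - i) div 2 - (n - i - j) div 2 = j"
    "n + j - i < 2 * n" "(n - i - j) div 2 < n" "even (n + j - i) \<longleftrightarrow> even (n - i - j)"
  using cell_cases[OF assms(3)] assms by (auto; fail)+

lemma cell_column:
  assumes "1 \<le> i" "1 \<le> j" "i + j \<le> n"
  shows "column n t (n + j - i) ((n - i - j) div 2) = t i j"
  using cell_position[OF assms] by (simp add: column_def)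

lemma column_cell:
  assumes "0 < n - Suc x div 2 - p" "0 < x div 2 - p"
  defines "i \<equiv> n - Suc x div 2 - p" and "j \<equiv> x div 2 - p"
  shows "i + j \<le> n" "n + j - i = x" "(n - i - j) div 2 = p"
proof -
  consider "x = 2 * (p + j)" "n = i + j + 2 * p" | "x = 2 * (p + j) + 1" "n = i + j + 2 * p + 1"
  proof (cases "even x")
    case True
    then obtain y where y: "x = 2 * y" by (rule evenE)
    then have "n = y + p + i" "y = p + j" using assms by auto
    then show ?thesis using y by (intro that(1)) auto
  next
    case False
    then obtain y where y: "x = 2 * y + 1" by (rule oddE)
    then have "n = Suc y + p + i" "y = p + j" using assms by auto
    then show ?thesis using y by (intro that(2)) auto
  qed
  then show "i + j \<le> n" "n + j - i = x" "(n - i - j) div 2 = p" by (cases; simp)+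
qed

lemma less_column_unlevels:
  assumes l: "l \<in> fam k (2 * n) (\<lambda>_. 0)"
  shows "q < column n (unlevels n k l) x p \<longleftrightarrow> q < k \<and> p < l x (k - Suc q)"
proof (cases "0 < n - Suc x div 2 - p \<and> 0 < x div 2 - p")
  case True
  have "column n (unlevels n k l) x p = card {q. q < k \<and> p < l x (k - Suc q)}"
    unfolding column_def unlevels_def using True column_cell[of n x p] by simp
  moreover have "p < l x (k - Suc q)" if "p < l x (k - Suc (Suc q))" for q
  proof (cases "Suc q < k")
    case True
    have "l x (k - Suc (Suc q)) \<le> l x (k - Suc q)"
      by (rule parts_mono[OF fam_parts[OF l]]) (use True in auto)
    then show ?thesis using that by simp
  qed (use that in simp)
  ultimately show ?thesis
    using less_card_downset[of "\<lambda>q. p < l x (k - Suc q)" q k] by simp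
next
  case False
  then have "column n (unlevels n k l) x p = 0" by (auto simp: column_def unlevels_def)
  \<comment> \<open>Such a position is a cell on an axis; \<open>fam_bounds\<close> guarantees that
    no path reaches beyond it, so replacing its entry by 0 loses nothing.\<close>
  moreover have "\<not> (q < k \<and> p < l x (k - Suc q))"
    using fam_bounds[OF l, of "k - Suc q" x] False by linarith
  ultimately show ?thesis by simp
qed

lemma unlevels_rpp:
  assumes l: "l \<in> fam k (2 * n) (\<lambda>_. 0)"
  shows "unlevels n k l \<in> rpp n k"
proof -
  let ?u = "unlevels n k l"
  have step: "trans_step k x (l x) (l (Suc x))" if "x < 2 * n" for x
    using l that by (simp add: fam_def)
  have "?u i j \<le> ?u i' j'" if h: "(i', j') = (Suc i, j) \<or> (i', j') = (i, Suc j)" for i j i' j'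
  proof -
    consider "i = 0 \<or> j = 0" | "1 \<le> i" "1 \<le> j" "n \<le> i + j" | "1 \<le> i" "1 \<le> j" "i + j < n" by linarith
    then show ?thesis
    proof cases
      case 1
      then show ?thesis by (auto simp: unlevels_def)
    next
      case 2
      have "?u i j \<le> k"
        using card_mono[of "{..<k}" "{q. q < k \<and> (n - i - j) div 2 < l (n + j - i) (k - Suc q)}"]
        by (auto simp: unlevels_def)
      moreover have "?u i' j' = k" using 2 h by (auto simp: unlevels_def)
      ultimately show ?thesis by simp
    next
      case 3
      define x p where "x = n + j - i" and "p = (n - i - j) div 2"
      have "i + j \<le> n" using 3 by simp
      then consider "x = 2 * (j + p)" "n = i + j + 2 * p" "0 < p" | "x = 2 * (j + p) + 1" "n = i + j + 2 * p + 1"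
      proof (cases rule: cell_cases)
        case (1 p')
        then show ?thesis using 3 by (intro that(1)) (auto simp: x_def p_def)
      next
        case (2 p')
        then show ?thesis by (intro that(2)) (auto simp: x_def p_def)
      qed
      note c = this
      define x' p' where "x' = n + j' - i'" and "p' = (n - i' - j') div 2"
      have x: "x < 2 * n" "x' < 2 * n" using 3 h by (auto simp: x_def x'_def)
      \<comment> \<open>Moving down or right changes the diagonal by one and lowers the position by
        one exactly in the parity case where the path may be one lower on the new diagonal.\<close>
      have "p' < l x' r" if r: "r < k" "p < l x r" for r
        using h
      proof
        assume h1: "(i', j') = (Suc i, j)"
        then have xx: "x = Suc x'" using 3 by (auto simp: x_def x'_def)
        have p: "if even x' then p' = p else p = Suc p'"
          using c
        proof cases
          case 1
          moreover obtain p0 where "p = Suc p0" using 1 by (cases p) auto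
          ultimately show ?thesis using xx h1 by (auto simp: p'_def)
        next
          case 2
          then show ?thesis using xx h1 by (auto simp: p'_def)
        qed
        show ?thesis using step[OF x(2)] p r by (auto simp: xx trans_step_def split: if_splits)
      next
        assume h1: "(i', j') = (i, Suc j)"
        then have xx: "x' = Suc x" using 3 by (auto simp: x_def x'_def)
        have p: "if even x then p = Suc p' else p' = p"
          using c
        proof cases
          case 1
          moreover obtain p0 where "p = Suc p0" using 1 by (cases p) auto
          ultimately show ?thesis using h1 by (auto simp: p'_def)
        next
          case 2
          then show ?thesis using h1 by (auto simp: p'_def)
        qed
        show ?thesis using step[OF x(1)] p r by (auto simp: xx trans_step_def split: if_splits)
      qed
      then have "{q. q < k \<and> p < l x (k - Suc q)} \<subseteq> {q. q < k \<and> p' < l x' (k - Suc q)}" by auto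
      then have "card {q. q < k \<and> p < l x (k - Suc q)} \<le> card {q. q < k \<and> p' < l x' (k - Suc q)}"
        by (intro card_mono) auto
      moreover have "?u i j = card {q. q < k \<and> p < l x (k - Suc q)}"
        using 3 by (simp add: unlevels_def x_def p_def)
      moreover have "?u i' j' = card {q. q < k \<and> p' < l x' (k - Suc q)}"
        using 3 h by (auto simp: unlevels_def x'_def p'_def)
      ultimately show ?thesis by simp
    qed
  qed
  then have "?u i j \<le> ?u (Suc i) j \<and> ?u i j \<le> ?u i (Suc j)" for i j by blast
  then show ?thesis unfolding rpp_def by (auto simp: unlevels_def)
qed

lemma unlevels_levels:
  assumes t: "t \<in> rpp n k"
  shows "unlevels n k (levels n k t) = t"
proof (intro ext)
  fix i j
  let ?u = "unlevels n k (levels n k t)"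
  consider "i = 0 \<or> j = 0" | "1 \<le> i" "1 \<le> j" "n < i + j" | "1 \<le> i" "1 \<le> j" "i + j \<le> n" by linarith
  then show "?u i j = t i j"
  proof cases
    case 1
    then show ?thesis using rpp_zero[OF t] by (auto simp: unlevels_def)
  next
    case 2
    then show ?thesis using rpp_outside[OF t] by (auto simp: unlevels_def)
  next
    case 3
    define x p where "x = n + j - i" and "p = (n - i - j) div 2"
    have "q < column n ?u x p \<longleftrightarrow> q < column n t x p" for q
    proof (cases "q < k")
      case True
      then have "k - Suc (k - Suc q) = q" by simp
      then show ?thesis using True less_column_unlevels[OF levels_fam[OF t], of q x p] less_levels[OF t, of p x "k - Suc q"]
        by simp
    next
      case False
      moreover have "column n t x p \<le> k" unfolding column_def by (rule rpp_le[OF t])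
      ultimately show ?thesis using less_column_unlevels[OF levels_fam[OF t], of q x p] by simp
    qed
    then have "column n ?u x p = column n t x p" by (metis less_irrefl linorder_neqE_nat)
    then show ?thesis unfolding x_def p_def cell_column[OF 3] .
  qed
qed

lemma levels_unlevels:
  assumes l: "l \<in> fam k (2 * n) (\<lambda>_. 0)"
  shows "levels n k (unlevels n k l) = l"
proof (intro ext)
  fix x r
  have "p < levels n k (unlevels n k l) x r \<longleftrightarrow> p < l x r" for p
  proof (cases "r < k")
    case True
    then have "k - Suc (k - Suc r) = r" by simp
    then show ?thesis
      using True less_levels[OF unlevels_rpp[OF l], of p x r] less_column_unlevels[OF l, of "k - Suc r" x p] by simp
  next
    case False
    moreover have "l x r = 0" using fam_parts[OF l, of x] False by (simp add: parts_def)
    ultimately show ?thesis using less_levels[OF unlevels_rpp[OF l], of p x r] by simp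
  qed
  then show "levels n k (unlevels n k l) x r = l x r" by (metis less_irrefl linorder_neqE_nat)
qed

lemma levels_bij: "bij_betw (levels n k) (rpp n k) (fam k (2 * n) (\<lambda>_. 0))"
  by (rule bij_betw_byWitness[where f' = "unlevels n k"])
    (use unlevels_levels levels_unlevels levels_fam unlevels_rpp in blast)+

section \<open>Exponents of path families\<close>

lemma sum_levels:
  assumes t: "t \<in> rpp n k"
  shows "(\<Sum>r<k. int (levels n k t x r)) = (\<Sum>p<n. int (column n t x p))"
proof -
  have "int (levels n k t x r) = (\<Sum>p<n. of_bool (k - Suc r < column n t x p))" if "r < k" for r
  proof -
    have "{p. p < n \<and> r < k \<and> k - Suc r < column n t x p} = {..<n} \<inter> {p. k - Suc r < column n t x p}"
      using that by auto
    then show ?thesis unfolding levels_def by (simp add: sum.If_cases of_bool_def)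
  qed
  then have "(\<Sum>r<k. int (levels n k t x r)) = (\<Sum>r<k. \<Sum>p<n. of_bool (k - Suc r < column n t x p))"
    by simp
  \<comment> \<open>Exchanging the sums counts the boxes of a partition and of its
    conjugate.\<close>
  also have "\<dots> = (\<Sum>p<n. \<Sum>r<k. of_bool (k - Suc r < column n t x p))" by (rule sum.swap)
  also have "\<dots> = (\<Sum>p<n. int (column n t x p))"
  proof (rule sum.cong[OF refl])
    fix p
    have le: "column n t x p \<le> k" unfolding column_def by (rule rpp_le[OF t])
    then have "{..<k} \<inter> {r. k - Suc r < column n t x p} = {k - column n t x p..<k}" by auto
    then show "(\<Sum>r<k. of_bool (k - Suc r < column n t x p)) = int (column n t x p)"
      using le by (simp add: sum.If_cases of_bool_def)
  qed
  finally show ?thesis .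
qed

lemma altsum_eq:
  assumes t: "t \<in> rpp n k"
  shows "altsum s t = (\<Sum>u\<le>s. (-1) ^ (s - u) * antisum u t)"
proof (induction s)
  case 0
  then show ?case using rpp_zero[OF t] by (simp add: antisum_def)
next
  case (Suc s)
  have "(\<Sum>u\<le>s. (-1) ^ (Suc s - u) * antisum u t) = - (\<Sum>u\<le>s. (-1) ^ (s - u) * antisum u t)"
    unfolding sum_negf[symmetric] by (intro sum.cong) (auto simp: Suc_diff_le)
  then show ?case using Suc by simp
qed

lemma altsum_columns:
  assumes t: "t \<in> rpp n k"
  shows "altsum n t = (\<Sum>x<2 * n. (-1) ^ x * (\<Sum>p<n. int (column n t x p)))"
proof -
  have "altsum n t = (\<Sum>s\<le>n. \<Sum>i\<le>s. (-1) ^ (n - i - (s - i)) * int (t i (s - i)))"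
    unfolding altsum_eq[OF t] antisum_def sum_distrib_left by (intro sum.cong refl) auto
  also have "\<dots> = (\<Sum>(i, j)\<in>staircase n. (-1) ^ (n - i - j) * int (t i j))"
    by (rule sum_staircase_antidiagonals[symmetric]) (use rpp_zero[OF t] in auto)
  also have "\<dots> = (\<Sum>(x, p)\<in>{..<2 * n} \<times> {..<n}. (-1) ^ x * int (column n t x p))"
  proof (rule sum.reindex_bij_witness_not_neutral[where S' = "{}" and
        T' = "{(x, p) \<in> {..<2 * n} \<times> {..<n}. \<not> (0 < n - Suc x div 2 - p \<and> 0 < x div 2 - p)}" and
        j = "\<lambda>(i, j). (n + j - i, (n - i - j) div 2)" and
        i = "\<lambda>(x, p). (n - Suc x div 2 - p, x div 2 - p)"])
    fix a assume "a \<in> staircase n - {}"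
    then obtain i j where a: "a = (i, j)" "1 \<le> i" "1 \<le> j" "i + j \<le> n" by (auto simp: staircase_def)
    define x p where xp: "x = n + j - i" "p = (n - i - j) div 2"
    note * = cell_position[OF a(2-4), folded xp]
    show "(case case a of (i, j) \<Rightarrow> (n + j - i, (n - i - j) div 2) of
        (x, p) \<Rightarrow> (n - Suc x div 2 - p, x div 2 - p)) = a"
      unfolding a(1) prod.case xp[symmetric] using * by simp
    show "(case a of (i, j) \<Rightarrow> (n + j - i, (n - i - j) div 2)) \<in> {..<2 * n} \<times> {..<n} -
        {(x, p) \<in> {..<2 * n} \<times> {..<n}. \<not> (0 < n - Suc x div 2 - p \<and> 0 < x div 2 - p)}"
      unfolding a(1) prod.case xp[symmetric] using * a(2,3) by auto
  next
    fix b assume "b \<in> {..<2 * n} \<times> {..<n} -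
        {(x, p) \<in> {..<2 * n} \<times> {..<n}. \<not> (0 < n - Suc x div 2 - p \<and> 0 < x div 2 - p)}"
    then obtain x p where b: "b = (x, p)" "0 < n - Suc x div 2 - p" "0 < x div 2 - p" by auto
    note * = column_cell[OF b(2,3)]
    show "(case case b of (x, p) \<Rightarrow> (n - Suc x div 2 - p, x div 2 - p) of
        (i, j) \<Rightarrow> (n + j - i, (n - i - j) div 2)) = b"
      unfolding b(1) prod.case * ..
    show "(case b of (x, p) \<Rightarrow> (n - Suc x div 2 - p, x div 2 - p)) \<in> staircase n - {}"
      unfolding b(1) prod.case Diff_empty staircase_iff using *(1) b(2,3) by linarith
  next
    fix a assume "a \<in> staircase n"
    then obtain i j where a: "a = (i, j)" "1 \<le> i" "1 \<le> j" "i + j \<le> n" by (auto simp: staircase_def)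
    have "(-1 :: int) ^ (n + j - i) = (-1) ^ (n - i - j)"
      using cell_position(5)[OF a(2-4)] by (simp add: minus_one_power_iff)
    then show "(case case a of (i, j) \<Rightarrow> (n + j - i, (n - i - j) div 2) of
        (x, p) \<Rightarrow> (-1) ^ x * int (column n t x p)) =
      (case a of (i, j) \<Rightarrow> (-1) ^ (n - i - j) * int (t i j))"
      using cell_column[OF a(2-4), of t] a(1) by simp
  next
    fix b assume "b \<in> {(x, p) \<in> {..<2 * n} \<times> {..<n}. \<not> (0 < n - Suc x div 2 - p \<and> 0 < x div 2 - p)}"
    then show "(case b of (x, p) \<Rightarrow> (-1) ^ x * int (column n t x p)) = 0"
      using rpp_zero[OF t] by (auto simp: column_def)
  qed (auto intro: finite_subset[of _ "{..<2 * n} \<times> {..<n}"])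
  also have "\<dots> = (\<Sum>x<2 * n. (-1) ^ x * (\<Sum>p<n. int (column n t x p)))"
    by (simp add: sum.cartesian_product sum_distrib_left)
  finally show ?thesis .
qed

text \<open>In the alternating sum each odd diagonal is paired with the following even one; the
  unpaired end terms belong to diagonals \<open>0\<close> and \<open>2 * n\<close>, whose entries
  all vanish.\<close>

lemma altsum_gain:
  assumes t: "t \<in> rpp n k"
  shows "altsum n t = (\<Sum>x<2 * n. gain k x (levels n k t x) (levels n k t (Suc x)))"
proof -
  define c where "c x = (\<Sum>p<n. int (column n t x p))" for x
  have g: "gain k x (levels n k t x) (levels n k t (Suc x)) = (if even x then 0 else c (Suc x) - c x)" for x
    unfolding gain_def c_def sum_subtractf sum_levels[OF t] by simp
  have "(\<Sum>x<2 * m. if even x then 0 else c (Suc x) - c x) = (\<Sum>x<2 * m. (-1) ^ x * c x) + c (2 * m) - c 0" for m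
    by (induction m) simp_all
  moreover have "c 0 = 0" "c (2 * n) = 0" using rpp_zero[OF t] by (simp_all add: c_def column_def)
  ultimately show ?thesis unfolding g altsum_columns[OF t] c_def[symmetric] by simp
qed

section \<open>The determinant formula\<close>

lemma card_excited_det:
  "real (card (excited (staircase (n + 2 * k)) (staircase n))) =
    real_of_int (det (mat k k (\<lambda>(i, j). int (little_schroeder (n + i + j))))) / 2 ^ (k choose 2)"
proof -
  have "real (card (excited (staircase (n + 2 * k)) (staircase n))) = (\<Sum>t\<in>rpp n k. 2 powi altsum n t)"
    unfolding card_excited card_svt sum_rpp_altsum ..
  also have "\<dots> = (\<Sum>t\<in>rpp n k. 2 powi (\<Sum>x<2 * n. gain k x (levels n k t x) (levels n k t (Suc x))))"
    using altsum_gain by simp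
  also have "\<dots> = (\<Sum>l\<in>fam k (2 * n) (\<lambda>_. 0). 2 powi (\<Sum>x<2 * n. gain k x (l x) (l (Suc x))))"
    by (rule sum.reindex_bij_betw[OF levels_bij])
  also have "\<dots> = minor k (2 * n) (\<lambda>_. 0)"
    using minor_fam[of "\<lambda>_. 0" k "2 * n"] by (simp add: parts_def)
  also have "\<dots> = det (mat k k (\<lambda>(i, j). walk n i j))"
  proof -
    have "mat k k (\<lambda>(r, i). walk n i r) = transpose_mat (mat k k (\<lambda>(i, j). walk n i j))"
      by (rule eq_matI) auto
    then show ?thesis
      unfolding minor_def rowdet_def by (simp add: walk_def[symmetric] det_transpose[of _ k])
  qed
  also have "\<dots> = det (mat k k (\<lambda>(a, b). walk (n + a + b) 0 0)) / 2 ^ (k choose 2)"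
    by (simp add: det_hankel_walk)
  also have "mat k k (\<lambda>(a, b). walk (n + a + b) 0 0) =
      map_mat real_of_int (mat k k (\<lambda>(i, j). int (little_schroeder (n + i + j))))"
    by (rule eq_matI) (auto simp: little_schroeder_walk)
  finally show ?thesis by (simp only: of_int_hom.hom_det)
qed

theorem theorem5p9:
  fixes n :: nat
  assumes "n \<ge> 1"
  shows "card (excited (staircase (n + 2)) (staircase n)) = little_schroeder n
    \<and> real (card (excited (staircase (n + 4)) (staircase n))) =
        (real (little_schroeder n) * real (little_schroeder (n + 2))
          - real (little_schroeder (n + 1)) ^ 2) / 2
    \<and> (\<forall>k::nat. k \<ge> 1 \<longrightarrow>
        real (card (excited (staircase (n + 2 * k)) (staircase n))) =
          real_of_int (det (mat k k (\<lambda>(i, j). int (little_schroeder (n + i + j)))))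
          / 2 ^ (k choose 2))"
proof (intro conjI allI impI)
  have "real (card (excited (staircase (n + 2 * 1)) (staircase n))) = real (little_schroeder n)"
    unfolding card_excited_det by (subst det_single) (auto simp: numeral_2_eq_2)
  then show "card (excited (staircase (n + 2)) (staircase n)) = little_schroeder n" by simp
  have "real (card (excited (staircase (n + 2 * 2)) (staircase n))) =
      (real (little_schroeder n) * real (little_schroeder (n + 2)) - real (little_schroeder (n + 1)) ^ 2) / 2"
    unfolding card_excited_det by (subst laplace_expansion_row[of _ 2 0]) (auto simp: cofactor_def mat_delete_def det_single numeral_2_eq_2)
  then show "real (card (excited (staircase (n + 4)) (staircase n))) =
      (real (little_schroeder n) * real (little_schroeder (n + 2)) - real (little_schroeder (n + 1)) ^ 2) / 2"
    by simp
qed (rule card_excited_det)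

end
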